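(* Let $X$ be a compact metric space and let $T:X\to X$ be an expanding map. Then there is an open and dense set $\mathcal{O}\subset \mathrm{Lip}(X,\mathbb{R})$ (for the topology of the Lipschitz norm) such that for every $F\in\mathcal{O}$ there is a single $F$-maximizing measure and this measure is supported on a periodic orbit of $T$.
   Context: $(X,d)$ is a non-empty compact metric space. A map $T:X\to X$ is expanding if it is Lipschitz continuous and there are $D\in\mathbb{Z}^+$ and $0<\lambda<1$ such that every $x\in X$ has a neighborhood $U_x$, an integer $1\le \ell_x\le D$ and continuous maps $S_i:U_x\to X$, $i=1,\dots,\ell_x$ (branches of the inverse of $T$), with pairwise disjoint images, such that $T^{-1}(U_x)=\bigcup_{i=1}^{\ell_x}S_i(U_x)$, $T\circ S_i=\mathrm{id}_{U_x}$ for all $i$, and $d(S_i(y),S_i(z))\le\lambda\, d(y,z)$ for all $y,z\in U_x$ and all $i$. $\mathrm{Lip}(X,\mathbb{R})$ is the space of Lipschitz functions $f:X\to\mathbb{R}$ with the norm $\|f\|=\sup_{x\in X}|f(x)|+\sup_{x\ne y}\frac{|f(x)-f(y)|}{d(x,y)}$. $\mathcal{M}(T)$ is the set of $T$-invariant Borel probability measures on $X$. For a continuous $F:X\to\mathbb{R}$, an $F$-maximizing measure is a $\mu\in\mathcal{M}(T)$ with $\int F\,d\mu=\sup\{\int F\,d\nu:\nu\in\mathcal{M}(T)\}$. A periodic orbit is a set $\{y,T(y),\dots,T^{p-1}(y)\}$ with $p\ge1$ and $T^p(y)=y$. *)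

theory Defs
  imports "HOL-Probability.Probability"
begin

definition expanding :: "('a::metric_space \<Rightarrow> 'a) \<Rightarrow> bool" where
  "expanding T \<longleftrightarrow>
     (\<exists>L. L-lipschitz_on UNIV T) \<and>
     (\<exists>D::nat. \<exists>l::real. D > 0 \<and> 0 < l \<and> l < 1 \<and>
       (\<forall>x. \<exists>U. x \<in> interior U \<and>
         (\<exists>n. 1 \<le> n \<and> n \<le> D \<and>
           (\<exists>S :: nat \<Rightarrow> 'a \<Rightarrow> 'a.
             (\<forall>i\<in>{1..n}. continuous_on U (S i)) \<and>
             disjoint_family_on (\<lambda>i. S i ` U) {1..n} \<and>
             T -` U = (\<Union>i\<in>{1..n}. S i ` U) \<and>
             (\<forall>i\<in>{1..n}. \<forall>y\<in>U. T (S i y) = y) \<and>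
             (\<forall>i\<in>{1..n}. \<forall>y\<in>U. \<forall>z\<in>U. dist (S i y) (S i z) \<le> l * dist y z)))))"

definition lip_functions :: "('a::metric_space \<Rightarrow> real) set" where
  "lip_functions = {f. \<exists>L. L-lipschitz_on UNIV f}"

text \<open>The second supremum ranges over all pairs. Since division by zero yields zero, the
  diagonal only contributes the value 0; this leaves the supremum over distinct points unchanged
  and makes it 0 on a one-point space, where there are no distinct points.\<close>

definition lip_norm :: "('a::metric_space \<Rightarrow> real) \<Rightarrow> real" where
  "lip_norm f = (SUP x. \<bar>f x\<bar>) + (SUP (x, y). \<bar>f x - f y\<bar> / dist x y)"

text \<open>The locale \<^locale>\<open>Metric_space\<close> requires a distance that is non-negative also outside the
  carrier, where it is irrelevant to the topology.\<close>

definition lip_dist :: "('a::metric_space \<Rightarrow> real) \<Rightarrow> ('a \<Rightarrow> real) \<Rightarrow> real" where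
  "lip_dist f g =
     (if f \<in> lip_functions \<and> g \<in> lip_functions then lip_norm (\<lambda>x. f x - g x) else 0)"

definition lip_topology :: "('a::metric_space \<Rightarrow> real) topology" where
  "lip_topology = Metric_space.mtopology lip_functions lip_dist"

definition invariant_measures :: "('a::metric_space \<Rightarrow> 'a) \<Rightarrow> 'a measure set" where
  "invariant_measures T = {\<mu>. prob_space \<mu> \<and> sets \<mu> = sets borel \<and> distr \<mu> borel T = \<mu>}"

definition maximizing_measure ::
    "('a::metric_space \<Rightarrow> 'a) \<Rightarrow> ('a \<Rightarrow> real) \<Rightarrow> 'a measure \<Rightarrow> bool" where
  "maximizing_measure T F \<mu> \<longleftrightarrow> \<mu> \<in> invariant_measures T \<and>
     integral\<^sup>L \<mu> F = (SUP \<nu>\<in>invariant_measures T. integral\<^sup>L \<nu> F)"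

definition periodic_orbit :: "('a \<Rightarrow> 'a) \<Rightarrow> 'a set \<Rightarrow> bool" where
  "periodic_orbit T A \<longleftrightarrow>
     (\<exists>y p. p \<ge> 1 \<and> (T ^^ p) y = y \<and> A = (\<lambda>k. (T ^^ k) y) ` {..<p})"

text \<open>On a compact space the topology above is that of a genuine metric.\<close>

lemma lip_functions_diff:
  assumes "f \<in> lip_functions" "g \<in> lip_functions"
  shows "(\<lambda>x. f x - g x) \<in> lip_functions"
  using assms unfolding lip_functions_def by (auto intro: lipschitz_on_diff)

lemma lip_bdd_above_abs:
  fixes f :: "'a::metric_space \<Rightarrow> real"
  assumes "compact (UNIV :: 'a set)" "f \<in> lip_functions"
  shows "bdd_above (range (\<lambda>x. \<bar>f x\<bar>))"
proof -
  have "continuous_on UNIV f"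
    using assms(2) unfolding lip_functions_def
    by (auto intro: lipschitz_on_continuous_on)
  then have "compact (range (\<lambda>x. \<bar>f x\<bar>))"
    by (intro compact_continuous_image assms(1) continuous_intros)
  then show ?thesis
    by (simp add: bounded_imp_bdd_above compact_imp_bounded)
qed

lemma lip_bdd_above_quot:
  fixes f :: "'a::metric_space \<Rightarrow> real"
  assumes "f \<in> lip_functions"
  shows "bdd_above (range (\<lambda>(x, y). \<bar>f x - f y\<bar> / dist x y))"
proof -
  obtain L where L: "L-lipschitz_on UNIV f"
    using assms unfolding lip_functions_def by auto
  have "\<bar>f x - f y\<bar> / dist x y \<le> L" for x y
    using lipschitz_onD[OF L, of x y] lipschitz_on_nonneg[OF L]
    by (cases "x = y") (auto simp: dist_real_def divide_simps)
  then show ?thesis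
    by (intro bdd_aboveI[of _ L]) auto
qed

lemma lip_norm_ge_abs:
  fixes f :: "'a::metric_space \<Rightarrow> real"
  assumes "compact (UNIV :: 'a set)" "f \<in> lip_functions"
  shows "\<bar>f x\<bar> \<le> lip_norm f"
proof -
  have "\<bar>f x\<bar> \<le> (SUP x. \<bar>f x\<bar>)"
    by (rule cSUP_upper[OF _ lip_bdd_above_abs[OF assms]]) simp
  moreover have "0 \<le> (SUP (x, y). \<bar>f x - f y\<bar> / dist x y)"
    using cSUP_upper[OF UNIV_I lip_bdd_above_quot[OF assms(2)], of "(x, x)"] by simp
  ultimately show ?thesis
    unfolding lip_norm_def by linarith
qed

lemma lip_norm_triangle:
  fixes f g :: "'a::metric_space \<Rightarrow> real"
  assumes "compact (UNIV :: 'a set)" "f \<in> lip_functions" "g \<in> lip_functions"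
  shows "lip_norm (\<lambda>x. f x + g x) \<le> lip_norm f + lip_norm g"
proof -
  have "(SUP x. \<bar>f x + g x\<bar>) \<le> (SUP x. \<bar>f x\<bar>) + (SUP x. \<bar>g x\<bar>)"
  proof (rule cSUP_least)
    fix x
    have "\<bar>f x\<bar> \<le> (SUP x. \<bar>f x\<bar>)" "\<bar>g x\<bar> \<le> (SUP x. \<bar>g x\<bar>)"
      by (rule cSUP_upper[OF UNIV_I lip_bdd_above_abs[OF assms(1)]], fact)+
    then show "\<bar>f x + g x\<bar> \<le> (SUP x. \<bar>f x\<bar>) + (SUP x. \<bar>g x\<bar>)"
      by linarith
  qed simp
  moreover have "(SUP (x, y). \<bar>(f x + g x) - (f y + g y)\<bar> / dist x y)
      \<le> (SUP (x, y). \<bar>f x - f y\<bar> / dist x y) + (SUP (x, y). \<bar>g x - g y\<bar> / dist x y)"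
  proof (rule cSUP_least, simp, clarify)
    fix x y
    have "\<bar>f x - f y\<bar> / dist x y \<le> (SUP (x, y). \<bar>f x - f y\<bar> / dist x y)"
      "\<bar>g x - g y\<bar> / dist x y \<le> (SUP (x, y). \<bar>g x - g y\<bar> / dist x y)"
      using cSUP_upper[OF UNIV_I lip_bdd_above_quot[OF assms(2)], of "(x, y)"]
        cSUP_upper[OF UNIV_I lip_bdd_above_quot[OF assms(3)], of "(x, y)"] by simp_all
    moreover have "\<bar>(f x + g x) - (f y + g y)\<bar> / dist x y
        \<le> \<bar>f x - f y\<bar> / dist x y + \<bar>g x - g y\<bar> / dist x y"
      unfolding add_divide_distrib[symmetric] by (intro divide_right_mono) auto
    ultimately show "\<bar>(f x + g x) - (f y + g y)\<bar> / dist x y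
        \<le> (SUP (x, y). \<bar>f x - f y\<bar> / dist x y) + (SUP (x, y). \<bar>g x - g y\<bar> / dist x y)"
      by linarith
  qed
  ultimately show ?thesis
    unfolding lip_norm_def by linarith
qed

lemma Metric_space_lip:
  assumes "compact (UNIV :: 'a::metric_space set)"
  shows "Metric_space (lip_functions :: ('a \<Rightarrow> real) set) lip_dist"
proof
  fix f g h :: "'a \<Rightarrow> real"
  show "0 \<le> lip_dist f g"
    using order_trans[OF abs_ge_zero lip_norm_ge_abs[OF assms lip_functions_diff]]
    by (auto simp: lip_dist_def)
  have "lip_norm (\<lambda>x. f x - g x) = lip_norm (\<lambda>x. g x - f x)"
    unfolding lip_norm_def
    by (intro arg_cong2[where f = "(+)"] arg_cong[where f = Sup] image_cong)
       (auto simp: abs_if algebra_simps)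
  then show "lip_dist f g = lip_dist g f"
    by (simp add: lip_dist_def)
  show "lip_dist f g = 0 \<longleftrightarrow> f = g"
    if "f \<in> lip_functions" "g \<in> lip_functions"
  proof
    assume "lip_dist f g = 0"
    then have "lip_norm (\<lambda>x. f x - g x) = 0"
      using that by (simp add: lip_dist_def)
    then show "f = g"
      using lip_norm_ge_abs[OF assms lip_functions_diff[OF that]] by (intro ext) force
  qed (simp add: lip_dist_def lip_norm_def case_prod_beta)
  show "lip_dist f h \<le> lip_dist f g + lip_dist g h"
    if "f \<in> lip_functions" "g \<in> lip_functions" "h \<in> lip_functions"
    using lip_norm_triangle[OF assms lip_functions_diff[OF that(1,2)]
        lip_functions_diff[OF that(2,3)]] that by (simp add: lip_dist_def)
qed

end

theory Submission
  imports Defs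
begin

text \<open>
  Let \<open>f\<close> be Lipschitz. Adding a coboundary and a constant changes neither the maximizing
  measures nor their uniqueness, and by the lemma of Mane (\<open>normal_form\<close>) this brings \<open>f\<close> into
  the form of a Lipschitz function \<open>g \<le> 0\<close> that vanishes on a non-empty forward invariant set
  \<open>Z\<close>. Let \<open>S\<close> be a periodic orbit and subtract a small multiple of the distance to \<open>S\<close>. Every
  invariant measure not carried by \<open>S\<close> pays for its distance from \<open>S\<close>, while the measure on \<open>S\<close>
  pays at most the Lipschitz constant of \<open>g\<close> times the average distance from \<open>S\<close> to \<open>Z\<close>. The
  penalty that an orbit pays when it leaves \<open>S\<close> is proportional to the gap of \<open>S\<close>, the least
  distance between two of its points (capped at the scale on which \<open>T\<close> expands): within a fixed
  fraction of the gap, an orbit can only follow \<open>S\<close> and drift away from it exponentially. So the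
  measure on \<open>S\<close> becomes the only maximizing one, with some room to spare for further
  perturbations that are small in the Lipschitz norm, as soon as the sum over \<open>S\<close> of the
  distances to \<open>Z\<close> is a sufficiently small multiple of the gap of \<open>S\<close>. This is
  \<open>unique_maximizing_near_normal_form\<close>, based on the estimate \<open>birkhoff_sum_locked\<close>.

  It remains to find such an \<open>S\<close> for every \<open>Z\<close> (\<open>separated_periodic_orbit\<close>, after Huang, Lian,
  Ma, Xu and Zhang). If two points of a periodic orbit are closer than a multiple of the sum of
  the distances to \<open>Z\<close>, then the orbit splits there into two pieces that nearly close up; the
  shorter one is shadowed by a periodic orbit of at most half the period, and the sum of the
  distances has grown by at most a constant factor. The process stops after a number of steps
  logarithmic in the period, so the sum grows in total by at most a fixed power of the initial
  period. Hence it is enough to start from a periodic orbit that is closer to \<open>Z\<close> than any given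
  negative power of its period.

  That such orbits exist is a theorem of Bressaud and Quas (\<open>superpolynomial_approximation\<close>).
  Code \<open>Z\<close> by a finite partition, and let \<open>h\<close> be the exponential growth rate of the number of
  words. For a suitable length \<open>m\<close> there are at most \<open>exp ((h + \<eta>) * m)\<close> words of length \<open>m\<close>,
  and at least \<open>exp (h * n * m)\<close> ways to concatenate \<open>n\<close> of them to a word of \<open>Z\<close>. If the graph
  of admissible transitions between words of length \<open>m\<close> had no short cycle, then such a
  concatenation would be determined by the set of its \<open>n\<close> members, since an acyclic graph has at
  most one Hamiltonian path; this would give at most \<open>exp ((h + \<eta>) * n * m) / fact n\<close>
  concatenations, which is too few once \<open>n\<close> exceeds \<open>exp (1 + \<eta> * m)\<close>. So there is a cycle whose
  length is at most an exponential of small rate in \<open>m\<close>, while shadowing it produces a periodic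
  orbit whose distance to \<open>Z\<close> is of the order of \<open>lam ^ m\<close>.
\<close>

section \<open>Uniform expansion and inverse branches\<close>

text \<open>Near \<open>z\<close> the images of different branches stay apart, because they stay close to the
  finitely many distinct points \<open>S i z\<close>. So two nearby points with images close to \<open>z\<close> lie on the same
  branch, and the contraction of that branch is an expansion of \<open>T\<close>.\<close>
lemma local_inverse_branches:
  fixes T :: "'a::metric_space \<Rightarrow> 'a" and S :: "nat \<Rightarrow> 'a \<Rightarrow> 'a"
  assumes l: "0 < l" "l < 1" and z: "z \<in> interior U"
    and disj: "disjoint_family_on (\<lambda>i. S i ` U) {1..n}"
    and pre: "T -` U = (\<Union>i\<in>{1..n}. S i ` U)"
    and inv: "\<And>i y. i \<in> {1..n} \<Longrightarrow> y \<in> U \<Longrightarrow> T (S i y) = y"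
    and contr: "\<And>i y w. i \<in> {1..n} \<Longrightarrow> y \<in> U \<Longrightarrow> w \<in> U \<Longrightarrow> dist (S i y) (S i w) \<le> l * dist y w"
  shows "\<exists>r d. r > 0 \<and> d > 0 \<and>
    (\<forall>x y. T x \<in> ball z r \<longrightarrow> T y \<in> ball z r \<longrightarrow> dist x y < d \<longrightarrow> dist x y \<le> l * dist (T x) (T y)) \<and>
    (\<forall>x w. T x \<in> ball z r \<longrightarrow> w \<in> ball z r \<longrightarrow> (\<exists>x'. T x' = w \<and> dist x x' \<le> l * dist (T x) w))"
proof -
  obtain r0 where r0: "r0 > 0" "ball z r0 \<subseteq> U"
    using z by (meson mem_interior)
  have zU: "z \<in> U" using z interior_subset by blast
  (* The entry 1 keeps E non-empty when there is only one branch. *)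
  define E where "E = insert 1 ((\<lambda>(i, j). dist (S i z) (S j z)) ` {(i, j) \<in> {1..n} \<times> {1..n}. i \<noteq> j})"
  define e where "e = Min E"
  have "finite E"
    unfolding E_def
    by (intro finite.insertI finite_imageI, rule finite_subset[of _ "{1..n} \<times> {1..n}"]) auto
  moreover have "\<forall>a\<in>E. 0 < a"
  proof
    fix a assume "a \<in> E"
    then consider "a = 1" | i j where "i \<in> {1..n}" "j \<in> {1..n}" "i \<noteq> j" "a = dist (S i z) (S j z)"
      by (auto simp: E_def)
    then show "0 < a"
    proof cases
      case 2
      then have "S i ` U \<inter> S j ` U = {}"
        using disj unfolding disjoint_family_on_def by blast
      then have "S i z \<noteq> S j z" using zU by (metis disjoint_iff image_eqI)
      then show ?thesis using 2 by simp
    qed simp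
  qed
  ultimately have e: "e > 0" "\<And>a. a \<in> E \<Longrightarrow> e \<le> a"
    unfolding e_def by (auto simp: E_def)
  define r where "r = min r0 (e / 4)"
  have rU: "w \<in> U" if "w \<in> ball z r" for w
    using r0(2) that by (auto simp: r_def)
  have branch: "\<exists>i\<in>{1..n}. x = S i (T x)" if "T x \<in> ball z r" for x
  proof -
    have "x \<in> T -` U" using rU[OF that] by simp
    then obtain i u where "i \<in> {1..n}" "u \<in> U" "x = S i u" unfolding pre by blast
    then show ?thesis using inv by metis
  qed
  have near: "dist (S i w) (S i z) < e / 4" if "w \<in> ball z r" "i \<in> {1..n}" for w i
  proof -
    have "dist (S i w) (S i z) \<le> l * dist w z" using contr that rU zU by blast
    also have "\<dots> \<le> 1 * dist w z" using l by (intro mult_right_mono) auto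
    also have "\<dots> < e / 4" using that by (simp add: r_def dist_commute)
    finally show ?thesis .
  qed
  have "dist x y \<le> l * dist (T x) (T y)"
    if xy: "T x \<in> ball z r" "T y \<in> ball z r" "dist x y < e / 4" for x y
  proof -
    obtain i j where ij: "i \<in> {1..n}" "x = S i (T x)" "j \<in> {1..n}" "y = S j (T y)"
      using branch[OF xy(1)] branch[OF xy(2)] by blast
    have "i = j"
    proof (rule ccontr)
      assume "i \<noteq> j"
      then have "e \<le> dist (S i z) (S j z)"
        using ij by (intro e(2)) (auto simp: E_def)
      also have "\<dots> \<le> dist (S i z) x + dist x y + dist y (S j z)"
        by metric
      also have "\<dots> < e / 4 + e / 4 + e / 4"
        using near[OF that(1) ij(1)] near[OF that(2) ij(3)] ij that(3) by (simp add: dist_commute)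
      finally show False using e by simp
    qed
    then show ?thesis using contr[OF ij(1) rU rU, OF that(1,2)] ij by simp
  qed
  moreover have "\<exists>x'. T x' = w \<and> dist x x' \<le> l * dist (T x) w"
    if "T x \<in> ball z r" "w \<in> ball z r" for x w
    using branch[OF that(1)] contr[OF _ rU rU, OF _ that] inv[OF _ rU[OF that(2)]] by metis
  moreover have "r > 0" using r0 e by (simp add: r_def)
  ultimately show ?thesis using e(1) by (intro exI[of _ r] exI[of _ "e / 4"]) auto
qed

text \<open>The two consequences of expansion that the proof uses, with one scale \<open>rho\<close> for the whole
  space: \<open>T\<close> expands small distances, and a point near \<open>T x\<close> has a preimage near \<open>x\<close>.\<close>
locale uniformly_expanding =
  fixes T :: "'a::metric_space \<Rightarrow> 'a" and lam rho L :: real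
  assumes compact_space: "compact (UNIV :: 'a set)"
    and lam: "0 < lam" "lam < 1"
    and rho: "0 < rho"
    and L: "1 \<le> L"
    and lipschitz: "dist (T x) (T y) \<le> L * dist x y"
    and expand: "dist x y < rho \<Longrightarrow> dist x y \<le> lam * dist (T x) (T y)"
    and branch: "dist (T x) w < rho \<Longrightarrow> \<exists>x'. T x' = w \<and> dist x x' \<le> lam * dist (T x) w"

text \<open>The scale \<open>rho\<close> comes from a Lebesgue number of a finite cover by the balls of the preceding
  lemma, divided by the Lipschitz constant so that the images of nearby points share a ball.\<close>
lemma expanding_imp_uniformly_expanding:
  fixes T :: "'a::metric_space \<Rightarrow> 'a"
  assumes "compact (UNIV :: 'a set)" and "expanding T"
  shows "\<exists>lam rho L. uniformly_expanding T lam rho L"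
proof -
  obtain L0 l and D :: nat where L0: "L0-lipschitz_on UNIV T" and l: "0 < l" "l < 1"
    and loc: "\<forall>x. \<exists>U. x \<in> interior U \<and>
         (\<exists>n. 1 \<le> n \<and> n \<le> D \<and>
           (\<exists>S :: nat \<Rightarrow> 'a \<Rightarrow> 'a.
             (\<forall>i\<in>{1..n}. continuous_on U (S i)) \<and>
             disjoint_family_on (\<lambda>i. S i ` U) {1..n} \<and>
             T -` U = (\<Union>i\<in>{1..n}. S i ` U) \<and>
             (\<forall>i\<in>{1..n}. \<forall>y\<in>U. T (S i y) = y) \<and>
             (\<forall>i\<in>{1..n}. \<forall>y\<in>U. \<forall>z\<in>U. dist (S i y) (S i z) \<le> l * dist y z)))"
    using assms(2) unfolding expanding_def by (elim exE conjE) (rule that)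
  define P where "P z r d \<longleftrightarrow> r > 0 \<and> d > 0 \<and>
    (\<forall>x y. T x \<in> ball z r \<longrightarrow> T y \<in> ball z r \<longrightarrow> dist x y < d \<longrightarrow> dist x y \<le> l * dist (T x) (T y)) \<and>
    (\<forall>x w. T x \<in> ball z r \<longrightarrow> w \<in> ball z r \<longrightarrow> (\<exists>x'. T x' = w \<and> dist x x' \<le> l * dist (T x) w))"
    for z r and d :: real
  have "\<exists>r d. P z r d" for z
  proof -
    obtain U n and S :: "nat \<Rightarrow> 'a \<Rightarrow> 'a" where 1: "z \<in> interior U"
      "disjoint_family_on (\<lambda>i. S i ` U) {1..n}" "T -` U = (\<Union>i\<in>{1..n}. S i ` U)"
      and 2: "\<forall>i\<in>{1..n}. \<forall>y\<in>U. T (S i y) = y"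
      and 3: "\<forall>i\<in>{1..n}. \<forall>y\<in>U. \<forall>z\<in>U. dist (S i y) (S i z) \<le> l * dist y z"
      using loc[THEN spec, of z] by (elim exE conjE) (rule that)
    show ?thesis
      unfolding P_def by (rule local_inverse_branches[OF l 1 2[rule_format] 3[rule_format]])
  qed
  then obtain r d where rd: "P z (r z) (d z)" for z by metis
  have cover: "UNIV \<subseteq> (\<Union>z. ball z (r z))"
  proof
    fix z :: 'a
    have "z \<in> ball z (r z)" using rd[of z] unfolding P_def by simp
    then show "z \<in> (\<Union>z. ball z (r z))" by blast
  qed
  obtain C where C: "finite C" "UNIV \<subseteq> (\<Union>z\<in>C. ball z (r z))"
    using compactE_image[OF assms(1) _ cover] open_ball by metis
  have "C \<noteq> {}" using C by auto
  obtain e where e: "0 < e" "\<forall>x\<in>UNIV. \<exists>G\<in>(\<lambda>z. ball z (r z)) ` C. ball x e \<subseteq> G"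
    using Heine_Borel_lemma[OF assms(1) C(2)] by (metis (no_types, lifting) imageE open_ball)
  define d0 where "d0 = Min (d ` C)"
  have d0: "d0 > 0" "\<And>z. z \<in> C \<Longrightarrow> d0 \<le> d z"
    using C \<open>C \<noteq> {}\<close> rd by (auto simp: d0_def P_def)
  define L where "L = max 1 L0"
  have Tlip: "dist (T x) (T y) \<le> L * dist x y" for x y
    using lipschitz_onD[OF L0, of x y] mult_right_mono[of L0 L "dist x y"] by (simp add: L_def)
  define \<rho> where "\<rho> = min (e / L) d0"
  have "L \<ge> 1" by (simp add: L_def)
  then have le: "\<rho> \<le> e" using e by (auto simp: \<rho>_def min_le_iff_disj field_simps)
  have "uniformly_expanding T l \<rho> L"
  proof
    show "0 < \<rho>" using e d0 \<open>L \<ge> 1\<close> by (simp add: \<rho>_def)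
    show "dist x y \<le> l * dist (T x) (T y)" if "dist x y < \<rho>" for x y
    proof -
      obtain z where z: "z \<in> C" "ball (T x) e \<subseteq> ball z (r z)" using e by blast
      have "dist (T x) (T y) < e"
        using Tlip[of x y] that \<open>L \<ge> 1\<close> by (simp add: \<rho>_def field_simps)
      moreover have "dist x y < d z" using that d0(2)[OF z(1)] by (simp add: \<rho>_def)
      ultimately show ?thesis using rd[of z] z e(1) unfolding P_def
        by (meson centre_in_ball mem_ball subsetD)
    qed
    show "\<exists>x'. T x' = w \<and> dist x x' \<le> l * dist (T x) w" if "dist (T x) w < \<rho>" for x w
    proof -
      obtain z where z: "z \<in> C" "ball (T x) e \<subseteq> ball z (r z)" using e by blast
      have "dist (T x) w < e" using that le by simp
      then show ?thesis using rd[of z] z e(1) unfolding P_def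
        by (meson centre_in_ball mem_ball subsetD)
    qed
  qed (use assms l Tlip \<open>L \<ge> 1\<close> in auto)
  then show ?thesis by blast
qed

context uniformly_expanding
begin

lemma orbit_lipschitz: "dist ((T ^^ k) x) ((T ^^ k) y) \<le> L ^ k * dist x y"
proof (induction k)
  case (Suc k)
  have "dist ((T ^^ Suc k) x) ((T ^^ Suc k) y) \<le> L * dist ((T ^^ k) x) ((T ^^ k) y)"
    by (simp add: lipschitz)
  also have "\<dots> \<le> L * (L ^ k * dist x y)"
    using Suc L by (intro mult_left_mono) auto
  finally show ?case by (simp add: mult.assoc)
qed simp

lemma continuous_on_iterate: "continuous_on A (T ^^ k)"
  using orbit_lipschitz L
  by (intro lipschitz_on_continuous_on[of "L ^ k"] lipschitz_onI) auto

lemma expand_iterate: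
  assumes "\<And>i. i < n \<Longrightarrow> dist ((T ^^ i) x) ((T ^^ i) y) < rho"
  shows "dist x y \<le> lam ^ n * dist ((T ^^ n) x) ((T ^^ n) y)"
  using assms
proof (induction n)
  case (Suc n)
  have "dist x y \<le> lam ^ n * dist ((T ^^ n) x) ((T ^^ n) y)"
    using Suc by simp
  also have "\<dots> \<le> lam ^ n * (lam * dist ((T ^^ Suc n) x) ((T ^^ Suc n) y))"
    using expand[of "(T ^^ n) x" "(T ^^ n) y"] Suc.prems[of n] lam by (intro mult_left_mono) auto
  finally show ?case by (simp add: mult_ac)
qed simp

lemma expansive:
  assumes "\<And>i. dist ((T ^^ i) x) ((T ^^ i) y) < rho"
  shows "x = y"
proof -
  have "dist x y \<le> lam ^ n * rho" for n
  proof -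
    have "dist x y \<le> lam ^ n * dist ((T ^^ n) x) ((T ^^ n) y)"
      using assms by (intro expand_iterate)
    also have "\<dots> \<le> lam ^ n * rho"
      using assms[of n] lam by (intro mult_left_mono) auto
    finally show ?thesis .
  qed
  moreover have "(\<lambda>n. lam ^ n * rho) \<longlonglongrightarrow> 0"
    using tendsto_mult_right[OF LIMSEQ_power_zero[of lam], of rho] lam by simp
  ultimately have "dist x y \<le> 0"
    by (intro LIMSEQ_le_const) auto
  then show ?thesis by simp
qed

lemma subsequential_limit:
  fixes w :: "nat \<Rightarrow> 'a"
  obtains l r where "strict_mono (r :: nat \<Rightarrow> nat)" "(\<lambda>n. w (r n)) \<longlonglongrightarrow> l"
  using compact_space[unfolded compact_eq_seq_compact_metric, unfolded seq_compact_def, rule_format, of w]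
  by (auto simp: o_def)

text \<open>Here \<open>x\<close> is a periodic pseudo-orbit and \<open>e\<close> prescribes how closely it is to be followed at each
  time. The hypothesis \<open>contr\<close> says that pulling back along a branch reproduces the bound, so
  finite stretches are shadowed, and compactness gives a point \<open>y\<close> shadowing the whole sequence.
  Since \<open>(T ^^ P) y\<close> shadows the same sequence, expansivity makes it equal to \<open>y\<close>. A bound that varies
  in time is needed in the closing lemma below, where the shadowing distances have to be summed
  independently of the period.\<close>
lemma periodic_shadowing:
  fixes x :: "nat \<Rightarrow> 'a" and e :: "nat \<Rightarrow> real"
  assumes per: "\<And>i. x (i + P) = x i" "\<And>i. e (i + P) = e i"
    and step: "\<And>i. dist (T (x i)) (x (Suc i)) + e (Suc i) < rho"
    and contr: "\<And>i. lam * (dist (T (x i)) (x (Suc i)) + e (Suc i)) \<le> e i"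
    and e: "\<And>i. 0 \<le> e i" "\<And>i. 2 * e i < rho"
  shows "\<exists>y. (T ^^ P) y = y \<and> (\<forall>i. dist ((T ^^ i) y) (x i) \<le> e i)"
proof -
  have pull: "\<exists>w. \<forall>i\<le>n. dist ((T ^^ i) w) (x (k + i)) \<le> e (k + i)" for n k
  proof (induction n arbitrary: k)
    case 0
    show ?case using e by (intro exI[of _ "x k"]) auto
  next
    case (Suc n)
    obtain w where w: "\<And>i. i \<le> n \<Longrightarrow> dist ((T ^^ i) w) (x (Suc k + i)) \<le> e (Suc k + i)"
      using Suc[of "Suc k"] by blast
    have d: "dist (T (x k)) w \<le> dist (T (x k)) (x (Suc k)) + e (Suc k)"
      using w[of 0] dist_triangle2[of "T (x k)" w "x (Suc k)"] by simp
    then obtain w' where w': "T w' = w" "dist (x k) w' \<le> lam * dist (T (x k)) w"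
      using branch[of "x k" w] step[of k] by fastforce
    have "dist (x k) w' \<le> lam * (dist (T (x k)) (x (Suc k)) + e (Suc k))"
      using w'(2) mult_left_mono[OF d, of lam] lam by linarith
    then have w0: "dist w' (x k) \<le> e k"
      using contr[of k] by (simp add: dist_commute)
    have "dist ((T ^^ i) w') (x (k + i)) \<le> e (k + i)" if "i \<le> Suc n" for i
    proof (cases i)
      case (Suc j)
      then show ?thesis using w[of j] that w'(1) by (simp add: funpow_swap1)
    qed (use w0 in simp)
    then show ?case by blast
  qed
  then have "\<exists>w. \<forall>i\<le>n. dist ((T ^^ i) w) (x i) \<le> e i" for n
    using pull[of n 0] by simp
  then obtain w where w: "\<And>n i. i \<le> n \<Longrightarrow> dist ((T ^^ i) (w n)) (x i) \<le> e i"
    by metis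
  obtain y r where r: "strict_mono (r :: nat \<Rightarrow> nat)" "(\<lambda>n. w (r n)) \<longlonglongrightarrow> y"
    by (rule subsequential_limit)
  have y: "dist ((T ^^ i) y) (x i) \<le> e i" for i
  proof (rule LIMSEQ_le_const2)
    show "(\<lambda>n. dist ((T ^^ i) (w (r n))) (x i)) \<longlonglongrightarrow> dist ((T ^^ i) y) (x i)"
      using continuous_on_tendsto_compose[OF continuous_on_iterate[of UNIV] r(2)]
      by (intro tendsto_dist tendsto_const) auto
    show "\<exists>N. \<forall>n\<ge>N. dist ((T ^^ i) (w (r n))) (x i) \<le> e i"
      using w seq_suble[OF r(1)] le_trans by blast
  qed
  have "(T ^^ P) y = y"
  proof (rule expansive)
    fix i
    have "dist ((T ^^ i) ((T ^^ P) y)) (x i) \<le> e i"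
      using y[of "i + P"] per by (simp add: funpow_add)
    then show "dist ((T ^^ i) ((T ^^ P) y)) ((T ^^ i) y) < rho"
      using y[of i] e(2)[of i] dist_triangle2[of "(T ^^ i) ((T ^^ P) y)" "(T ^^ i) y" "x i"] by linarith
  qed
  then show ?thesis using y by blast
qed

lemma funpow_periodic:
  assumes "(T ^^ p) y = y"
  shows "(T ^^ (i + p)) y = (T ^^ i) y" "(T ^^ (i mod p)) y = (T ^^ i) y"
  using assms by (simp_all add: funpow_add funpow_mod_eq)

lemma geometric_sum_le: "(\<Sum>k<n. lam ^ k) \<le> 1 / (1 - lam)"
  using sum_le_suminf[of "\<lambda>k. lam ^ k" "{..<n}"] suminf_geometric[of lam] lam
  by (simp add: summable_geometric)

lemma geometric_sum_reverse_le: "(\<Sum>k<n. lam ^ (n - k)) \<le> 1 / (1 - lam)"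
proof -
  have "(\<Sum>k<n. lam ^ (n - k)) \<le> (\<Sum>k<n. lam ^ (n - Suc k))"
    using lam by (intro sum_mono power_decreasing) auto
  also have "\<dots> = (\<Sum>k<n. lam ^ k)" by (rule sum.nat_diff_reindex)
  finally show ?thesis using geometric_sum_le[of n] by linarith
qed

text \<open>The pseudo-orbit that repeats \<open>x, \<dots>, (T ^^ (p - 1)) x\<close> has a single jump per period, so the error
  decays geometrically backwards in time from that jump, and its sum does not depend on \<open>p\<close>.\<close>
lemma closing:
  assumes p: "p \<ge> 1" and d: "dist ((T ^^ p) x) x < (1 - lam) * rho / 2"
  shows "\<exists>y. (T ^^ p) y = y \<and>
    (\<Sum>k<p. dist ((T ^^ k) x) ((T ^^ k) y)) \<le> dist ((T ^^ p) x) x / (1 - lam)^2"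
proof -
  define c where "c = dist ((T ^^ p) x) x / (1 - lam)"
  define xx where "xx i = (T ^^ (i mod p)) x" for i
  define e where "e i = lam ^ (p - i mod p) * c" for i
  have c: "0 \<le> c" "2 * c < rho" "dist ((T ^^ p) x) x = (1 - lam) * c"
    using d lam by (auto simp: c_def field_simps)
  have e0: "0 \<le> e i" for i using c lam by (simp add: e_def)
  have ele: "e i \<le> lam * c" for i
  proof -
    have "lam ^ (p - i mod p) \<le> lam ^ 1"
      using lam p mod_less_divisor[of p i] by (intro power_decreasing) linarith+
    then show ?thesis using mult_right_mono[OF _ c(1), of "lam ^ (p - i mod p)" "lam ^ 1"]
      unfolding e_def by simp
  qed
  have lc: "lam * c \<le> c" using lam c by (simp add: mult_left_le_one_le)
  (* Either the pseudo-orbit is a true orbit at time i, or i is the last time of a period; there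
     the jump and the bound for the new period add up to at most c. *)
  have jump: "T (xx i) = xx (Suc i) \<and> lam * e (Suc i) = e i \<or>
    dist (T (xx i)) (xx (Suc i)) = (1 - lam) * c \<and> e i = lam * c" for i
  proof (cases "Suc (i mod p) = p")
    case True
    then have "Suc i mod p = 0" by (metis mod_Suc)
    moreover have "T (xx i) = (T ^^ p) x"
      using funpow.simps(2)[of "i mod p" T] True by (simp add: xx_def)
    moreover have "p - i mod p = 1" using True by linarith
    ultimately show ?thesis using c(3)
      by (simp add: xx_def e_def)
  next
    case False
    then have *: "Suc i mod p = Suc (i mod p)" by (metis mod_Suc)
    moreover have "p - i mod p = Suc (p - Suc (i mod p))"
      using p mod_less_divisor[of p i] by linarith
    ultimately show ?thesis by (simp add: xx_def e_def)
  qed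
  have "\<exists>y. (T ^^ p) y = y \<and> (\<forall>i. dist ((T ^^ i) y) (xx i) \<le> e i)"
  proof (rule periodic_shadowing)
    fix i
    show "xx (i + p) = xx i" "e (i + p) = e i" by (simp_all add: xx_def e_def)
    have "dist (T (xx i)) (xx (Suc i)) + e (Suc i) \<le> c"
      using jump[of i]
    proof
      assume "dist (T (xx i)) (xx (Suc i)) = (1 - lam) * c \<and> e i = lam * c"
      then show ?thesis using ele[of "Suc i"] by (simp add: algebra_simps)
    qed (use ele[of "Suc i"] lc in simp)
    then show "dist (T (xx i)) (xx (Suc i)) + e (Suc i) < rho"
      using c by linarith
    show "lam * (dist (T (xx i)) (xx (Suc i)) + e (Suc i)) \<le> e i"
      using jump[of i]
    proof
      assume "dist (T (xx i)) (xx (Suc i)) = (1 - lam) * c \<and> e i = lam * c"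
      then have "dist (T (xx i)) (xx (Suc i)) + e (Suc i) \<le> c"
        using ele[of "Suc i"] by (simp add: algebra_simps)
      then show ?thesis
        using mult_left_mono[of _ c lam] lam
          \<open>dist (T (xx i)) (xx (Suc i)) = (1 - lam) * c \<and> e i = lam * c\<close> by simp
    qed simp
    show "0 \<le> e i" by (rule e0)
    show "2 * e i < rho" using ele[of i] lc c by linarith
  qed
  then obtain y where y: "(T ^^ p) y = y" "\<And>i. dist ((T ^^ i) y) (xx i) \<le> e i" by blast
  have "(\<Sum>k<p. dist ((T ^^ k) x) ((T ^^ k) y)) \<le> (\<Sum>k<p. lam ^ (p - k) * c)"
  proof (rule sum_mono)
    fix k assume "k \<in> {..<p}"
    then show "dist ((T ^^ k) x) ((T ^^ k) y) \<le> lam ^ (p - k) * c"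
      using y(2)[of k] by (simp add: xx_def e_def dist_commute)
  qed
  also have "\<dots> \<le> 1 / (1 - lam) * c"
    unfolding sum_distrib_right[symmetric]
    using geometric_sum_reverse_le c by (intro mult_right_mono) auto
  also have "\<dots> = dist ((T ^^ p) x) x / (1 - lam)^2"
    by (simp add: c_def power2_eq_square)
  finally show ?thesis using y(1) by blast
qed

end

section \<open>Fast approximation of an invariant set by periodic orbits\<close>

text \<open>The itinerary of \<open>x\<close> up to time \<open>m\<close> with respect to the partition into the fibres of \<open>c\<close>.\<close>
definition word :: "('a \<Rightarrow> 'a) \<Rightarrow> ('a \<Rightarrow> 'b) \<Rightarrow> nat \<Rightarrow> 'a \<Rightarrow> 'b list" where
  "word T c m x = map (\<lambda>i. c ((T ^^ i) x)) [0..<m]"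

lemma length_word [simp]: "length (word T c m x) = m"
  by (simp add: word_def)

lemma word_eq_iff: "word T c m x = word T c m y \<longleftrightarrow> (\<forall>i<m. c ((T ^^ i) x) = c ((T ^^ i) y))"
  by (auto simp: word_def)

lemma word_append: "word T c (m + n) x = word T c m x @ word T c n ((T ^^ m) x)"
  by (rule nth_equalityI) (auto simp: word_def nth_append simp flip: funpow_add[unfolded o_def, THEN fun_cong])

lemma iterate_in_invariant:
  assumes "T ` Z \<subseteq> Z" "x \<in> Z"
  shows "(T ^^ k) x \<in> Z"
  using assms by (induction k) auto

lemma finite_words:
  assumes "T ` Z \<subseteq> Z" "finite (c ` Z)"
  shows "finite (word T c m ` Z)"
proof (rule finite_subset)
  show "word T c m ` Z \<subseteq> {xs. set xs \<subseteq> c ` Z \<and> length xs = m}"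
    using iterate_in_invariant[OF assms(1)] by (auto simp: word_def)
  show "finite {xs. set xs \<subseteq> c ` Z \<and> length xs = m}"
    by (rule finite_lists_length_eq[OF assms(2)])
qed

lemma card_words_add:
  assumes "T ` Z \<subseteq> Z" "finite (c ` Z)"
  shows "card (word T c (m + n) ` Z) \<le> card (word T c m ` Z) * card (word T c n ` Z)"
proof -
  have "word T c (m + n) ` Z \<subseteq> (\<lambda>(u, v). u @ v) ` (word T c m ` Z \<times> word T c n ` Z)"
  proof
    fix w assume "w \<in> word T c (m + n) ` Z"
    then obtain x where x: "x \<in> Z" "w = word T c m x @ word T c n ((T ^^ m) x)"
      by (auto simp: word_append)
    have "(word T c m x, word T c n ((T ^^ m) x)) \<in> word T c m ` Z \<times> word T c n ` Z"
      using iterate_in_invariant[OF assms(1) x(1), of m] x(1) by blast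
    then show "w \<in> (\<lambda>(u, v). u @ v) ` (word T c m ` Z \<times> word T c n ` Z)"
      by (rule rev_image_eqI) (simp add: x(2))
  qed
  moreover have fin: "finite (word T c m ` Z \<times> word T c n ` Z)"
    using finite_words[OF assms] by (intro finite_cartesian_product)
  ultimately have "card (word T c (m + n) ` Z) \<le>
      card ((\<lambda>(u, v). u @ v) ` (word T c m ` Z \<times> word T c n ` Z))"
    by (intro card_mono finite_imageI)
  also have "\<dots> \<le> card (word T c m ` Z \<times> word T c n ` Z)"
    by (rule card_image_le[OF fin])
  finally show ?thesis by (simp add: card_cartesian_product)
qed

lemma card_words_mult:
  fixes c :: "'a \<Rightarrow> 'b"
  assumes "T ` Z \<subseteq> Z" "finite (c ` Z)"
  shows "card (word T c (k * m) ` Z) \<le> card (word T c m ` Z) ^ k"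
proof (induction k)
  case 0
  have "word T c 0 ` Z \<subseteq> {[]}" by (auto simp: word_def)
  then show ?case using card_mono[of "{[] :: 'b list}" "word T c 0 ` Z"] by simp
next
  case (Suc k)
  have "card (word T c (Suc k * m) ` Z) \<le> card (word T c m ` Z) * card (word T c (k * m) ` Z)"
    using card_words_add[OF assms, of m "k * m"] by simp
  also have "\<dots> \<le> card (word T c m ` Z) * card (word T c m ` Z) ^ k"
    using Suc by (rule mult_left_mono) simp
  finally show ?case by simp
qed

text \<open>This is the uniqueness of a Hamiltonian path in an acyclic graph, for the relation \<open>r\<close> of being
  joined by a path.\<close>
lemma sorted_wrt_unique:
  assumes tr: "\<And>x y z. r x y \<Longrightarrow> r y z \<Longrightarrow> r x z" and irr: "\<And>x. \<not> r x x"
  shows "sorted_wrt r xs \<Longrightarrow> sorted_wrt r ys \<Longrightarrow> set xs = set ys \<Longrightarrow> xs = ys"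
proof (induction xs arbitrary: ys)
  case (Cons x xs)
  then obtain y ys' where ys: "ys = y # ys'" by (cases ys) auto
  have "x = y"
  proof (rule ccontr)
    assume "x \<noteq> y"
    then have "r x y" "r y x" using Cons.prems ys by auto
    then show False using tr irr by blast
  qed
  moreover have "x \<notin> set xs" "y \<notin> set ys'" using Cons.prems ys irr by auto
  ultimately have "set xs = set ys'" using Cons.prems(3) ys by auto
  then show ?case using Cons.IH[of ys'] Cons.prems ys \<open>x = y\<close> by simp
qed simp

text \<open>Without cycles of length at most \<open>n\<^sup>2\<close>, the \<open>n\<close> blocks of length \<open>m\<close> of a word are distinct, and
  the word can be recovered from the set of its blocks: on such a set the transition relation is
  acyclic, and the order of the blocks is its only Hamiltonian path. So there are at most
  \<open>N choose n\<close> words of length \<open>n * m\<close>, where \<open>N\<close> is the number of words of length \<open>m\<close>. The bound \<open>n\<^sup>2\<close>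
  on the length comes from counting the possible transitions between the blocks.\<close>
lemma short_cycle_if_many_words:
  fixes T :: "'a \<Rightarrow> 'a" and c :: "'a \<Rightarrow> 'b" and Z :: "'a set" and m n :: nat
  assumes inv: "T ` Z \<subseteq> Z" and fin: "finite (c ` Z)"
    and many: "card (word T c m ` Z) ^ n < card (word T c (n * m) ` Z) * fact n"
  defines "R \<equiv> {(word T c m x, word T c m ((T ^^ m) x)) | x. x \<in> Z}"
  shows "\<exists>q b. 1 \<le> q \<and> q \<le> n\<^sup>2 \<and> (b, b) \<in> R ^^ q"
proof (rule ccontr)
  assume no: "\<not> ?thesis"
  define blocks where "blocks x = map (\<lambda>j. word T c m ((T ^^ (j * m)) x)) [0..<n]" for x
  define V where "V = word T c m ` Z"
  have length_blocks: "length (blocks x) = n" for x by (simp add: blocks_def)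
  have concat: "concat (blocks x) = word T c (n * m) x" for x
  proof -
    have "concat (map (\<lambda>j. word T c m ((T ^^ (j * m)) x)) [0..<k]) = word T c (k * m) x" for k
    proof (induction k)
      case 0
      show ?case by (simp add: word_def)
    next
      case (Suc k)
      then show ?case using word_append[of T c "k * m" m x] by (simp add: add.commute)
    qed
    then show ?thesis by (simp add: blocks_def)
  qed
  have finV: "finite V" unfolding V_def by (rule finite_words[OF inv fin])
  have set_blocks: "set (blocks x) \<subseteq> V" if "x \<in> Z" for x
    using iterate_in_invariant[OF inv that] by (auto simp: blocks_def V_def)
  have acyclic: "(b, b) \<notin> (R \<inter> S \<times> S)\<^sup>+" if S: "finite S" "card S \<le> n" for b S
  proof
    assume "(b, b) \<in> (R \<inter> S \<times> S)\<^sup>+"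
    then obtain k where k: "k > 0" "(b, b) \<in> (R \<inter> S \<times> S) ^^ k"
      unfolding trancl_power by blast
    have finR: "finite (R \<inter> S \<times> S)" using S by auto
    have "(b, b) \<in> (\<Union>i\<in>{i. 0 < i \<and> i \<le> card (R \<inter> S \<times> S)}. (R \<inter> S \<times> S) ^^ i)"
      using relpow_finite_bounded1[OF finR k(1)] k(2) by blast
    then obtain q where q: "0 < q" "q \<le> card (R \<inter> S \<times> S)" "(b, b) \<in> (R \<inter> S \<times> S) ^^ q" by blast
    have "card (R \<inter> S \<times> S) \<le> card (S \<times> S)" using S by (intro card_mono) auto
    also have "\<dots> \<le> n\<^sup>2"
      using S by (simp add: card_cartesian_product power2_eq_square mult_mono)
    finally have "q \<le> n\<^sup>2" using q by linarith
    moreover have "(b, b) \<in> R ^^ q" using q(3) unfolding relpow_fun_conv by blast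
    ultimately show False using no q(1) by (metis Suc_leI One_nat_def)
  qed
  have sorted: "sorted_wrt (\<lambda>a b. (a, b) \<in> (R \<inter> S \<times> S)\<^sup>+) (blocks x)"
    if "x \<in> Z" "S = set (blocks x)" for x S
  proof -
    have tr: "transp (\<lambda>a b. (a, b) \<in> (R \<inter> S \<times> S)\<^sup>+)" by (auto intro: transpI trancl_trans)
    have "(blocks x ! i, blocks x ! Suc i) \<in> R" if "Suc i < n" for i
    proof -
      have "(T ^^ m) ((T ^^ (i * m)) x) = (T ^^ (Suc i * m)) x"
        by (simp add: funpow_add)
      then show ?thesis
        using that \<open>x \<in> Z\<close> iterate_in_invariant[OF inv, of x "i * m"]
        unfolding R_def blocks_def by (simp del: mult_Suc) metis
    qed
    moreover have "blocks x ! i \<in> S" if "i < n" for i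
      using that \<open>S = set (blocks x)\<close> by (simp add: blocks_def)
    ultimately show ?thesis
      unfolding sorted_wrt_iff_nth_Suc_transp[OF tr]
      by (auto intro!: r_into_trancl simp: length_blocks)
  qed
  have card_blocks: "card (set (blocks x)) \<le> n" for x
    using card_length[of "blocks x"] by (simp add: blocks_def)
  have distinct: "distinct (blocks x)" if "x \<in> Z" for x
  proof -
    have "\<not> (b, b) \<in> (R \<inter> set (blocks x) \<times> set (blocks x))\<^sup>+" for b
      using acyclic card_blocks by blast
    then show ?thesis
      using sorted[OF that refl] unfolding distinct_conv_nth sorted_wrt_iff_nth_less
      by (metis linorder_neqE_nat)
  qed
  have inj: "inj_on set (blocks ` Z)"
  proof (rule inj_onI, clarsimp)
    fix x y assume xy: "x \<in> Z" "y \<in> Z" "set (blocks x) = set (blocks y)"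
    show "blocks x = blocks y"
    proof (rule sorted_wrt_unique)
      show "sorted_wrt (\<lambda>a b. (a, b) \<in> (R \<inter> set (blocks x) \<times> set (blocks x))\<^sup>+) (blocks x)"
        "sorted_wrt (\<lambda>a b. (a, b) \<in> (R \<inter> set (blocks x) \<times> set (blocks x))\<^sup>+) (blocks y)"
        using sorted[OF xy(1) refl] sorted[OF xy(2,3)] by auto
    qed (use acyclic card_blocks xy in \<open>auto intro: trancl_trans\<close>)
  qed
  have fin_blocks: "finite (blocks ` Z)"
  proof (rule finite_subset)
    show "blocks ` Z \<subseteq> {xs. set xs \<subseteq> V \<and> length xs = n}"
      using set_blocks length_blocks by blast
  qed (rule finite_lists_length_eq[OF finV])
  have "word T c (n * m) ` Z = concat ` blocks ` Z"
    by (simp add: image_image concat)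
  then have "card (word T c (n * m) ` Z) \<le> card (blocks ` Z)"
    using card_image_le[OF fin_blocks] by simp
  also have "\<dots> = card (set ` blocks ` Z)"
    using card_image[OF inj] by simp
  also have "\<dots> \<le> card {S. S \<subseteq> V \<and> card S = n}"
  proof (rule card_mono)
    show "finite {S. S \<subseteq> V \<and> card S = n}" using finV by simp
    show "set ` blocks ` Z \<subseteq> {S. S \<subseteq> V \<and> card S = n}"
      using set_blocks distinct_card[OF distinct] length_blocks by fastforce
  qed
  also have "\<dots> = card V choose n" by (rule n_subsets[OF finV])
  finally have "card (word T c (n * m) ` Z) * fact n \<le> (card V choose n) * fact n"
    by (rule mult_right_mono) simp
  also have "\<dots> \<le> card V ^ n" by (rule binomial_fact_pow)
  finally show False using many by (simp add: V_def)
qed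

lemma power_self_le_fact_exp: "real n ^ n \<le> fact n * exp (real n)"
proof -
  have "(\<Sum>k\<in>{n}. real n ^ k /\<^sub>R fact k) \<le> exp (real n)"
    unfolding exp_def using summable_exp_generic[of "real n"]
    by (intro sum_le_suminf) auto
  then show ?thesis by (simp add: field_simps scaleR_conv_of_real)
qed

text \<open>With \<open>h\<close> the infimum of \<open>ln (N m) / m\<close>, submultiplicativity provides arbitrarily large \<open>m\<close> for
  which the number of words is within \<open>exp (\<eta> * m)\<close> of the lower bound \<open>exp (h * m)\<close>. For such \<open>m\<close> the
  counting argument applies as soon as \<open>fact n\<close> beats \<open>exp (\<eta> * m) ^ n\<close>.\<close>
lemma short_cycle:
  fixes T :: "'a \<Rightarrow> 'a" and c :: "'a \<Rightarrow> 'b" and Z :: "'a set" and \<eta> :: real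
  assumes inv: "T ` Z \<subseteq> Z" and fin: "finite (c ` Z)" and ne: "Z \<noteq> {}" and \<eta>: "\<eta> > 0"
  shows "\<exists>m\<ge>M. \<exists>q z. 1 \<le> m \<and> 1 \<le> q \<and> real q \<le> exp (2 * (2 + \<eta> * m)) \<and>
    (\<forall>i. z i \<in> Z \<and> z (i + q) = z i \<and> word T c m ((T ^^ m) (z i)) = word T c m (z (Suc i)))"
proof -
  define N where "N m = card (word T c m ` Z)" for m
  have N1: "N m \<ge> 1" for m
    using ne finite_words[OF inv fin, of m] by (simp add: N_def Suc_le_eq card_gt_0_iff)
  define h where "h = (INF m\<in>{1..}. ln (N m) / real m)"
  have bdd: "bdd_below ((\<lambda>m. ln (N m) / real m) ` {1..})"
    using N1 by (intro bdd_belowI[of _ 0]) auto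
  have lower: "exp (h * m) \<le> N m" if "m \<ge> 1" for m
  proof -
    have "h \<le> ln (N m) / m" unfolding h_def using that by (intro cINF_lower[OF bdd]) auto
    then have "h * m \<le> ln (N m)" using that by (simp add: field_simps)
    then show ?thesis using N1[of m] by (simp add: ln_ge_iff)
  qed
  have "\<exists>m\<in>{1..}. ln (N m) / real m < h + \<eta>"
    using cINF_less_iff[OF _ bdd, of "h + \<eta>"] \<eta> unfolding h_def by auto
  then obtain m0 where m0: "m0 \<ge> 1" "ln (N m0) / real m0 < h + \<eta>" by auto
  (* The multiples of m0 inherit the upper bound of m0 by submultiplicativity. *)
  define m where "m = Suc M * m0"
  have m: "m \<ge> M" "m \<ge> 1"
    using m0(1) mult_le_mono2[of 1 m0 "Suc M"] by (auto simp: m_def)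
  have "ln (N m) \<le> (h + \<eta>) * m"
  proof -
    have "N m \<le> N m0 ^ Suc M"
      unfolding N_def m_def by (rule card_words_mult[OF inv fin])
    then have "real (N m) \<le> real (N m0) ^ Suc M" by (metis of_nat_le_iff of_nat_power)
    then have "ln (N m) \<le> ln (real (N m0) ^ Suc M)"
      using N1[of m] N1[of m0] by (subst ln_le_cancel_iff) auto
    also have "\<dots> = Suc M * ln (N m0)" using N1[of m0] by (subst ln_realpow) auto
    also have "\<dots> \<le> Suc M * ((h + \<eta>) * m0)"
      using m0 by (intro mult_left_mono) (auto simp: field_simps)
    also have "\<dots> = (h + \<eta>) * m" by (simp add: m_def algebra_simps)
    finally show ?thesis .
  qed
  then have upper: "N m \<le> exp ((h + \<eta>) * m)"
    using N1[of m] by (metis exp_le_cancel_iff exp_ln less_le_trans of_nat_0_less_iff zero_less_one)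
  define n where "n = Suc (nat \<lfloor>exp (1 + \<eta> * m)\<rfloor>)"
  have n1: "real n > exp (1 + \<eta> * m)" and n2: "real n \<le> exp (1 + \<eta> * m) + 1"
    unfolding n_def by (linarith, simp)
  have many: "N m ^ n < N (n * m) * fact n"
  proof -
    have "real (N m ^ n) \<le> exp ((h + \<eta>) * m) ^ n"
      using upper by (simp add: power_mono)
    also have "\<dots> = exp (h * (n * m)) * exp (\<eta> * m) ^ n"
      by (simp add: algebra_simps flip: exp_of_nat_mult exp_add)
    also have "\<dots> < exp (h * (n * m)) * fact n"
    proof (rule mult_strict_left_mono)
      have "exp (1 + \<eta> * m) ^ n < real n ^ n"
        using n1 by (intro power_strict_mono) (auto simp: n_def)
      also have "\<dots> \<le> fact n * exp (real n)" by (rule power_self_le_fact_exp)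
      finally have "exp (\<eta> * m) ^ n * exp (real n) < fact n * exp (real n)"
        by (simp add: algebra_simps flip: exp_of_nat_mult exp_add)
      then show "exp (\<eta> * m) ^ n < fact n" by simp
    qed simp
    also have "\<dots> \<le> N (n * m) * fact n"
    proof -
      have "1 \<le> n * m" using m by (simp add: n_def)
      from mult_right_mono[OF lower[OF this], of "fact n"] show ?thesis by simp
    qed
    finally have "real (N m ^ n) < real (N (n * m) * fact n)" by simp
    then show ?thesis by (simp only: of_nat_less_iff)
  qed
  define R where "R = {(word T c m x, word T c m ((T ^^ m) x)) | x. x \<in> Z}"
  obtain q b where q: "1 \<le> q" "q \<le> n\<^sup>2" "(b, b) \<in> R ^^ q"
    using short_cycle_if_many_words[OF inv fin many[unfolded N_def]] unfolding R_def by blast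
  then obtain f where f: "f 0 = b" "f q = b" "\<And>i. i < q \<Longrightarrow> (f i, f (Suc i)) \<in> R"
    unfolding relpow_fun_conv by blast
  have "\<exists>x\<in>Z. word T c m x = f i \<and> word T c m ((T ^^ m) x) = f (Suc i)" if "i < q" for i
    using f(3)[OF that] by (auto simp: R_def)
  then obtain g where g: "\<And>i. i < q \<Longrightarrow> g i \<in> Z \<and> word T c m (g i) = f i \<and>
      word T c m ((T ^^ m) (g i)) = f (Suc i)"
    by metis
  define z where "z i = g (i mod q)" for i
  have "z i \<in> Z \<and> z (i + q) = z i \<and> word T c m ((T ^^ m) (z i)) = word T c m (z (Suc i))" for i
  proof -
    have "i mod q < q" "Suc i mod q < q" using q by auto
    moreover have "f (Suc (i mod q)) = f (Suc i mod q)"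
      using f(1,2) by (simp add: mod_Suc)
    ultimately show ?thesis using g by (simp add: z_def)
  qed
  moreover have "real q \<le> exp (2 * (2 + \<eta> * m))"
  proof -
    have "2 \<le> exp (1::real)" using exp_ge_add_one_self[of 1] by simp
    moreover have "1 \<le> exp (1 + \<eta> * m)" using \<eta> by simp
    ultimately have "real n \<le> exp (1 + \<eta> * m) * exp 1"
      using n2 mult_left_mono[of 2 "exp (1::real)" "exp (1 + \<eta> * m)"] by linarith
    then have "real n \<le> exp (2 + \<eta> * m)" by (simp flip: exp_add)
    then have "real n ^ 2 \<le> exp (2 + \<eta> * m) ^ 2" by (intro power_mono) auto
    moreover have "real q \<le> real n ^ 2"
      using of_nat_mono[OF q(2), where ?'a = real] by simp
    moreover have "exp (2 + \<eta> * m) ^ 2 = exp (2 * (2 + \<eta> * m))"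
      by (simp flip: exp_of_nat_mult)
    ultimately show ?thesis by linarith
  qed
  ultimately show ?thesis using m q(1) by blast
qed

context uniformly_expanding
begin

lemma finite_partition:
  assumes "\<delta> > 0"
  obtains c :: "'a \<Rightarrow> 'a" where "finite (range c)" "\<And>x y. c x = c y \<Longrightarrow> dist x y < \<delta>"
proof -
  have cover: "(UNIV :: 'a set) \<subseteq> (\<Union>z. ball z (\<delta> / 2))"
  proof
    fix z :: 'a
    have "z \<in> ball z (\<delta> / 2)" using assms by simp
    then show "z \<in> (\<Union>z. ball z (\<delta> / 2))" by blast
  qed
  obtain K where K: "finite K" "(UNIV :: 'a set) \<subseteq> (\<Union>z\<in>K. ball z (\<delta> / 2))"
    by (rule compactE_image[OF compact_space _ cover]) auto
  have "\<forall>x. \<exists>z\<in>K. dist z x < \<delta> / 2"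
  proof
    fix x
    have "x \<in> (\<Union>z\<in>K. ball z (\<delta> / 2))" using K(2) by blast
    then show "\<exists>z\<in>K. dist z x < \<delta> / 2" by simp
  qed
  then obtain c where c: "\<And>x. c x \<in> K \<and> dist (c x) x < \<delta> / 2" by metis
  have "dist x y < \<delta>" if "c x = c y" for x y
    using c[of x] c[of y] that dist_triangle3[of x y "c x"] by auto
  moreover have "finite (range c)" using c K(1) by (metis finite_subset image_subsetI)
  ultimately show thesis using that by blast
qed

text \<open>The blocks of a short cycle are itineraries of points \<open>z i\<close> of \<open>Z\<close>, and the orbits of these points
  over \<open>m\<close> steps join to a periodic pseudo-orbit in \<open>Z\<close>. Its jumps are at most \<open>lam ^ (m - 1) * rho\<close>,
  because points with equal itineraries of length \<open>m\<close> are that close.\<close>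
lemma superpolynomial_approximation:
  assumes inv: "T ` Z \<subseteq> Z" and ne: "Z \<noteq> {}" and C: "C > 0"
  shows "\<exists>P y s. P \<ge> 1 \<and> (T ^^ P) y = y \<and> s > 0 \<and>
    (\<forall>i. infdist ((T ^^ i) y) Z \<le> s) \<and> s * real P ^ A \<le> C"
proof -
  obtain c :: "'a \<Rightarrow> 'a" where c: "finite (range c)" "\<And>x y. c x = c y \<Longrightarrow> dist x y < rho"
    using finite_partition[OF rho] by blast
  (* The period P is at most a constant times exp (3 * \<eta> * m); this choice of \<eta> makes
     lam * exp (3 * \<eta> * A) less than 1, so that lam ^ m beats P ^ A. *)
  define \<eta> where "\<eta> = ln (1 / lam) / (3 * A + 1)"
  have \<eta>: "\<eta> > 0" using lam by (simp add: \<eta>_def)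
  define \<mu> where "\<mu> = lam * exp (3 * \<eta> * A)"
  have "3 * \<eta> * A < ln (1 / lam)"
    using lam by (simp add: \<eta>_def field_simps ln_div add_strict_increasing)
  then have "exp (3 * \<eta> * A) < 1 / lam" using lam by (metis divide_pos_pos exp_less_cancel_iff exp_ln zero_less_one)
  then have \<mu>: "0 < \<mu>" "\<mu> < 1" using lam by (auto simp: \<mu>_def field_simps)
  define B where "B = rho / (1 - lam) * (exp 4 / \<eta>) ^ A"
  have B: "B > 0" using lam rho \<eta> by (simp add: B_def)
  have "(\<lambda>m. B * \<mu> ^ m) \<longlonglongrightarrow> 0"
    using tendsto_mult_right_zero[OF LIMSEQ_power_zero[of \<mu>], of B] \<mu> by simp
  then have "eventually (\<lambda>m. B * \<mu> ^ m < C) sequentially"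
    using C by (rule order_tendstoD)
  moreover have "(\<lambda>m. lam ^ m) \<longlonglongrightarrow> 0" using lam by (intro LIMSEQ_power_zero) simp
  then have "eventually (\<lambda>m. lam ^ m < lam * (1 - lam) / 2) sequentially"
    using lam by (intro order_tendstoD) auto
  ultimately obtain M where M: "\<And>m. m \<ge> M \<Longrightarrow> B * \<mu> ^ m < C \<and> lam ^ m < lam * (1 - lam) / 2"
    unfolding eventually_sequentially by (metis eventually_conj eventually_sequentially le_trans linear)
  obtain m q z where m: "M \<le> m" "1 \<le> m" and q: "1 \<le> q" "real q \<le> exp (2 * (2 + \<eta> * m))"
    and z: "\<And>i. z i \<in> Z" "\<And>i. z (i + q) = z i"
      "\<And>i. word T c m ((T ^^ m) (z i)) = word T c m (z (Suc i))"
    using short_cycle[OF inv _ ne \<eta>, of c M] finite_subset[OF image_mono[OF subset_UNIV] c(1)] by metis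
  define P where "P = q * m"
  define d where "d = lam ^ (m - 1) * rho"
  define s where "s = lam * d / (1 - lam)"
  define xx where "xx i = (T ^^ (i mod m)) (z (i div m))" for i
  have lm: "lam ^ (m - 1) = lam ^ m / lam" using lam m by (cases m) auto
  have d: "d > 0" "d / (1 - lam) < rho / 2"
  proof -
    show "d > 0" using lam rho by (simp add: d_def)
    have "lam ^ m / lam < (1 - lam) / 2"
      using lam M[OF m(1)] by (simp add: divide_less_eq mult.commute)
    then have "d < (1 - lam) / 2 * rho"
      unfolding d_def lm using rho by (rule mult_strict_right_mono)
    then show "d / (1 - lam) < rho / 2" using lam by (simp add: divide_less_eq mult_ac)
  qed
  have s: "s > 0" "d + s = d / (1 - lam)" using lam d by (auto simp: s_def field_simps)
  have xxZ: "xx i \<in> Z" for i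
    unfolding xx_def by (rule iterate_in_invariant[OF inv z(1)])
  have jump: "dist (T (xx i)) (xx (Suc i)) \<le> d" for i
  proof (cases "Suc (i mod m) = m")
    case True
    then have *: "Suc i mod m = 0" "Suc i div m = Suc (i div m)"
      by (auto simp: mod_Suc div_Suc)
    define u v where "u = (T ^^ m) (z (i div m))" and "v = z (Suc (i div m))"
    have "\<forall>j<m. dist ((T ^^ j) u) ((T ^^ j) v) < rho"
      using z(3)[of "i div m"] c(2) unfolding word_eq_iff u_def v_def by blast
    then have j: "\<And>j. j < m \<Longrightarrow> dist ((T ^^ j) u) ((T ^^ j) v) < rho" by blast
    have "dist u v \<le> lam ^ (m - 1) * dist ((T ^^ (m - 1)) u) ((T ^^ (m - 1)) v)"
      using j by (intro expand_iterate) auto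
    also have "\<dots> \<le> d"
      unfolding d_def using j[of "m - 1"] m lam by (intro mult_left_mono) auto
    finally have "dist u v \<le> d" .
    moreover have "T (xx i) = u"
      using funpow.simps(2)[of "i mod m" T] True by (simp add: xx_def u_def)
    ultimately show ?thesis using * by (simp add: xx_def v_def)
  next
    case False
    then have "Suc i mod m = Suc (i mod m)" "Suc i div m = i div m"
      by (auto simp: mod_Suc div_Suc)
    then show ?thesis using d by (simp add: xx_def)
  qed
  have "\<exists>y. (T ^^ P) y = y \<and> (\<forall>i. dist ((T ^^ i) y) (xx i) \<le> s)"
  proof (rule periodic_shadowing)
    fix i
    show "xx (i + P) = xx i" using z(2)[of "i div m"] m by (simp add: xx_def P_def add.commute)
    show "dist (T (xx i)) (xx (Suc i)) + s < rho" using jump[of i] s d rho by linarith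
    have "lam * (dist (T (xx i)) (xx (Suc i)) + s) \<le> lam * (d + s)"
      using jump[of i] lam by (intro mult_left_mono) auto
    then show "lam * (dist (T (xx i)) (xx (Suc i)) + s) \<le> s" by (simp add: s(2)) (simp add: s_def)
    show "0 \<le> s" "2 * s < rho" using s d by linarith+
  qed simp
  then obtain y where y: "(T ^^ P) y = y" "\<And>i. dist ((T ^^ i) y) (xx i) \<le> s" by blast
  have "infdist ((T ^^ i) y) Z \<le> s" for i
    using infdist_le[OF xxZ[of i], of "(T ^^ i) y"] y(2)[of i] by linarith
  moreover have "s * real P ^ A \<le> C"
  proof -
    have "\<eta> * m \<le> exp (\<eta> * m)" using exp_ge_add_one_self[of "\<eta> * m"] by linarith
    then have "real m \<le> exp (\<eta> * m) / \<eta>" using \<eta> by (simp add: field_simps)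
    then have "real P \<le> exp (2 * (2 + \<eta> * m)) * (exp (\<eta> * m) / \<eta>)"
      unfolding P_def of_nat_mult using q(2) by (intro mult_mono) auto
    also have "\<dots> = exp 4 / \<eta> * exp (3 * \<eta> * m)"
      by (simp add: algebra_simps flip: exp_add)
    finally have "real P ^ A \<le> (exp 4 / \<eta> * exp (3 * \<eta> * m)) ^ A" by (intro power_mono) auto
    also have "\<dots> = (exp 4 / \<eta>) ^ A * exp (3 * \<eta> * A) ^ m"
      by (simp add: power_mult_distrib power_divide mult_ac flip: exp_of_nat_mult)
    finally have PA: "real P ^ A \<le> (exp 4 / \<eta>) ^ A * exp (3 * \<eta> * A) ^ m" .
    have "s = rho / (1 - lam) * lam ^ m"
      using lam by (simp only: s_def d_def lm) (simp add: field_simps)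
    then have "s * real P ^ A \<le> rho / (1 - lam) * lam ^ m * ((exp 4 / \<eta>) ^ A * exp (3 * \<eta> * A) ^ m)"
      using PA s(1) mult_left_mono[OF PA, of s] by simp
    also have "\<dots> = B * \<mu> ^ m" by (simp add: B_def \<mu>_def power_mult_distrib)
    finally show ?thesis using M[OF m(1)] by linarith
  qed
  moreover have "P \<ge> 1" using m q by (simp add: P_def)
  ultimately show ?thesis using y(1) s(1) by blast
qed

end

section \<open>Periodic orbits close to an invariant set compared to their gap\<close>

context uniformly_expanding
begin

lemma sum_over_period:
  fixes f :: "'a \<Rightarrow> real"
  assumes "(T ^^ p) y = y"
  shows "(\<Sum>k<p. f ((T ^^ k) ((T ^^ a) y))) = (\<Sum>k<p. f ((T ^^ k) y))"
proof (induction a)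
  case (Suc a)
  define z where "z = (T ^^ a) y"
  have z: "(T ^^ p) z = z"
    using funpow_periodic(1)[OF assms, of a] unfolding z_def
    by (simp add: add.commute flip: funpow_add[unfolded o_def, THEN fun_cong])
  have "(\<Sum>k<Suc p. f ((T ^^ k) z)) = f z + (\<Sum>k<p. f ((T ^^ Suc k) z))"
    using sum.lessThan_Suc_shift[of "\<lambda>k. f ((T ^^ k) z)" p] by simp
  then have "(\<Sum>k<p. f ((T ^^ k) (T z))) = (\<Sum>k<p. f ((T ^^ k) z))"
    using z by (simp add: funpow_swap1)
  then show ?case using Suc by (simp add: z_def)
qed simp

text \<open>A near-return of \<open>y\<close> to itself cuts the periodic orbit into two pieces that almost close up; the
  closing lemma applies to the shorter one.\<close>
lemma halve_periodic_orbit: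
  assumes p: "(T ^^ p) y = y" "i < j" "j < p"
    and close: "dist ((T ^^ i) y) ((T ^^ j) y) < \<gamma>" and \<gamma>: "\<gamma> \<le> (1 - lam) * rho / 2"
  shows "\<exists>q y'. 1 \<le> q \<and> 2 * q \<le> p \<and> (T ^^ q) y' = y' \<and>
    (\<Sum>k<q. infdist ((T ^^ k) y') Z) \<le> (\<Sum>k<p. infdist ((T ^^ k) y) Z) + \<gamma> / (1 - lam)^2"
proof -
  have *: "\<exists>y'. (T ^^ q) y' = y' \<and>
    (\<Sum>k<q. infdist ((T ^^ k) y') Z) \<le> (\<Sum>k<p. infdist ((T ^^ k) y) Z) + \<gamma> / (1 - lam)^2"
    if q: "1 \<le> q" "q \<le> p" and d: "dist ((T ^^ q) ((T ^^ a) y)) ((T ^^ a) y) < \<gamma>" for a q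
  proof -
    define x where "x = (T ^^ a) y"
    have dx: "dist ((T ^^ q) x) x < \<gamma>" using d by (simp add: x_def)
    then obtain y' where y': "(T ^^ q) y' = y'"
      "(\<Sum>k<q. dist ((T ^^ k) x) ((T ^^ k) y')) \<le> dist ((T ^^ q) x) x / (1 - lam)^2"
      using closing[OF q(1), of x] \<gamma> by auto
    have "(\<Sum>k<q. infdist ((T ^^ k) y') Z) \<le>
        (\<Sum>k<q. infdist ((T ^^ k) x) Z + dist ((T ^^ k) x) ((T ^^ k) y'))"
      by (intro sum_mono) (metis infdist_triangle dist_commute)
    also have "\<dots> = (\<Sum>k<q. infdist ((T ^^ k) x) Z) + (\<Sum>k<q. dist ((T ^^ k) x) ((T ^^ k) y'))"
      by (rule sum.distrib)
    also have "\<dots> \<le> (\<Sum>k<p. infdist ((T ^^ k) y) Z) + \<gamma> / (1 - lam)^2"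
    proof (rule add_mono)
      have "(\<Sum>k<q. infdist ((T ^^ k) x) Z) \<le> (\<Sum>k<p. infdist ((T ^^ k) x) Z)"
        using q by (intro sum_mono2) (auto simp: infdist_nonneg)
      also have "\<dots> = (\<Sum>k<p. infdist ((T ^^ k) y) Z)"
        unfolding x_def using sum_over_period[OF p(1), of "\<lambda>x. infdist x Z" a] .
      finally show "(\<Sum>k<q. infdist ((T ^^ k) x) Z) \<le> (\<Sum>k<p. infdist ((T ^^ k) y) Z)" .
      have "dist ((T ^^ q) x) x / (1 - lam)^2 \<le> \<gamma> / (1 - lam)^2"
        using dx by (intro divide_right_mono) auto
      then show "(\<Sum>k<q. dist ((T ^^ k) x) ((T ^^ k) y')) \<le> \<gamma> / (1 - lam)^2"
        using y'(2) by linarith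
    qed
    finally show ?thesis using y'(1) by blast
  qed
  have ji: "(T ^^ (j - i)) ((T ^^ i) y) = (T ^^ j) y"
    using p by (simp flip: funpow_add[unfolded o_def, THEN fun_cong])
  have ij: "(T ^^ (p - (j - i))) ((T ^^ j) y) = (T ^^ i) y"
  proof -
    have "p - (j - i) + j = i + p" using p by linarith
    then have "(T ^^ (p - (j - i))) ((T ^^ j) y) = (T ^^ (i + p)) y"
      using funpow_add[of "p - (j - i)" j T] by (metis comp_apply)
    then show ?thesis
      using funpow_periodic(1)[OF p(1), of i] by simp
  qed
  show ?thesis
  proof (cases "2 * (j - i) \<le> p")
    case True
    have "\<exists>y'. (T ^^ (j - i)) y' = y' \<and> (\<Sum>k<j - i. infdist ((T ^^ k) y') Z) \<le>
      (\<Sum>k<p. infdist ((T ^^ k) y) Z) + \<gamma> / (1 - lam)^2"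
      using p close ji by (intro *[of _ i]) (auto simp: dist_commute)
    then show ?thesis using True p by (intro exI[of _ "j - i"]) auto
  next
    case False
    have "\<exists>y'. (T ^^ (p - (j - i))) y' = y' \<and> (\<Sum>k<p - (j - i). infdist ((T ^^ k) y') Z) \<le>
      (\<Sum>k<p. infdist ((T ^^ k) y) Z) + \<gamma> / (1 - lam)^2"
      using p close ij by (intro *[of _ j]) auto
    then show ?thesis using False p by (intro exI[of _ "p - (j - i)"]) auto
  qed
qed

text \<open>Halving the period multiplies the bound \<open>\<kappa>\<close> by at most \<open>2 ^ A\<close>, so \<open>\<kappa> * real p ^ A\<close> does not
  increase. This invariant keeps \<open>\<kappa>\<close> below the scale on which the closing lemma works.\<close>
lemma separated_periodic_orbit_by_halving:
  assumes \<tau>: "\<tau> > 0" and A: "1 + 1 / (\<tau> * (1 - lam)^2) \<le> 2 ^ A"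
    and "1 \<le> p" "(T ^^ p) y = y" "\<kappa> > 0"
    and "(\<Sum>k<p. infdist ((T ^^ k) y) Z) \<le> \<kappa>"
    and "\<kappa> * real p ^ A \<le> \<tau> * ((1 - lam) * rho / 2)"
  shows "\<exists>p y \<gamma>. 1 \<le> p \<and> (T ^^ p) y = y \<and> 0 < \<gamma> \<and> \<gamma> \<le> rho \<and>
    (\<forall>i j. i < j \<longrightarrow> j < p \<longrightarrow> \<gamma> \<le> dist ((T ^^ i) y) ((T ^^ j) y)) \<and>
    (\<Sum>k<p. infdist ((T ^^ k) y) Z) \<le> \<tau> * \<gamma>"
  using assms(3-)
proof (induction p arbitrary: y \<kappa> rule: less_induct)
  case (less p)
  define \<gamma> where "\<gamma> = \<kappa> / \<tau>"
  have "\<kappa> * 1 \<le> \<kappa> * real p ^ A" using less.prems by (intro mult_left_mono) auto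
  then have "\<kappa> \<le> \<tau> * ((1 - lam) * rho / 2)" using less.prems by linarith
  then have \<gamma>: "0 < \<gamma>" "\<gamma> \<le> (1 - lam) * rho / 2" "\<tau> * \<gamma> = \<kappa>"
    using \<tau> less.prems(3) by (auto simp: \<gamma>_def field_simps)
  show ?case
  proof (cases "\<exists>i j. i < j \<and> j < p \<and> dist ((T ^^ i) y) ((T ^^ j) y) < \<gamma>")
    case False
    have "(1 - lam) * rho \<le> 1 * rho" using lam rho by (intro mult_right_mono) auto
    then have "\<gamma> \<le> rho" using \<gamma> rho by linarith
    then show ?thesis using False less.prems \<gamma>
      by (intro exI[of _ p] exI[of _ y] exI[of _ \<gamma>]) (auto simp flip: not_less)
  next
    case True
    then obtain i j where ij: "i < j" "j < p" "dist ((T ^^ i) y) ((T ^^ j) y) < \<gamma>" by blast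
    obtain q y' where q: "1 \<le> q" "2 * q \<le> p" "(T ^^ q) y' = y'"
      and sum: "(\<Sum>k<q. infdist ((T ^^ k) y') Z) \<le> (\<Sum>k<p. infdist ((T ^^ k) y) Z) + \<gamma> / (1 - lam)^2"
      using halve_periodic_orbit[OF less.prems(2) ij \<gamma>(2), of Z] by blast
    define \<kappa>' where "\<kappa>' = \<kappa> * (1 + 1 / (\<tau> * (1 - lam)^2))"
    have \<kappa>': "\<kappa>' > 0" unfolding \<kappa>'_def
      using less.prems(3) \<tau> by (intro mult_pos_pos add_pos_nonneg) auto
    have sum': "(\<Sum>k<q. infdist ((T ^^ k) y') Z) \<le> \<kappa>'"
    proof -
      have "\<kappa>' = \<kappa> + \<gamma> / (1 - lam)^2" using \<tau> by (simp add: \<kappa>'_def \<gamma>_def distrib_left)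
      then show ?thesis using sum less.prems(4) by linarith
    qed
    have "\<kappa>' * real q ^ A \<le> \<kappa> * 2 ^ A * real q ^ A"
      unfolding \<kappa>'_def using A less.prems(3) by (intro mult_right_mono mult_left_mono) auto
    also have "\<dots> = \<kappa> * real (2 * q) ^ A" by (simp add: power_mult_distrib)
    also have "\<dots> \<le> \<kappa> * real p ^ A"
      using q(2) less.prems(3) by (intro mult_left_mono power_mono) (auto simp flip: of_nat_mult)
    finally have "\<kappa>' * real q ^ A \<le> \<tau> * ((1 - lam) * rho / 2)" using less.prems(5) by linarith
    then show ?thesis
      using less.IH[of q y' \<kappa>'] q \<kappa>' sum' by auto
  qed
qed

lemma separated_periodic_orbit:
  assumes "T ` Z \<subseteq> Z" "Z \<noteq> {}" and \<tau>: "\<tau> > 0"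
  shows "\<exists>p y \<gamma>. 1 \<le> p \<and> (T ^^ p) y = y \<and> 0 < \<gamma> \<and> \<gamma> \<le> rho \<and>
    (\<forall>i j. i < j \<longrightarrow> j < p \<longrightarrow> \<gamma> \<le> dist ((T ^^ i) y) ((T ^^ j) y)) \<and>
    (\<Sum>k<p. infdist ((T ^^ k) y) Z) \<le> \<tau> * \<gamma>"
proof -
  obtain A where A: "1 + 1 / (\<tau> * (1 - lam)^2) \<le> 2 ^ A"
    using real_arch_pow[of 2 "1 + 1 / (\<tau> * (1 - lam)^2)"] by (auto intro: less_imp_le)
  have "\<tau> * ((1 - lam) * rho / 2) > 0" using \<tau> lam rho by simp
  from superpolynomial_approximation[OF assms(1,2) this, of "Suc A"]
  obtain P y s where P: "1 \<le> P" "(T ^^ P) y = y" "s > 0" "\<And>i. infdist ((T ^^ i) y) Z \<le> s"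
    "s * real P ^ Suc A \<le> \<tau> * ((1 - lam) * rho / 2)" by blast
  have "(\<Sum>k<P. infdist ((T ^^ k) y) Z) \<le> (\<Sum>k<P. s)" using P(4) by (rule sum_mono)
  then have "(\<Sum>k<P. infdist ((T ^^ k) y) Z) \<le> s * P" by (simp add: mult.commute)
  moreover have "s * P > 0" using P by simp
  ultimately show ?thesis
    using P by (intro separated_periodic_orbit_by_halving[OF \<tau> A P(1,2)]) (auto simp: mult_ac)
qed

end

section \<open>Sub-actions and the set of maximizing points\<close>

definition birkhoff_sum :: "('a \<Rightarrow> 'a) \<Rightarrow> ('a \<Rightarrow> real) \<Rightarrow> nat \<Rightarrow> 'a \<Rightarrow> real" where
  "birkhoff_sum T f n x = (\<Sum>k<n. f ((T ^^ k) x))"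

lemma birkhoff_sum_0 [simp]: "birkhoff_sum T f 0 x = 0"
  by (simp add: birkhoff_sum_def)

lemma birkhoff_sum_Suc: "birkhoff_sum T f (Suc n) x = birkhoff_sum T f n x + f ((T ^^ n) x)"
  by (simp add: birkhoff_sum_def)

lemma birkhoff_sum_add:
  "birkhoff_sum T f (m + n) x = birkhoff_sum T f m x + birkhoff_sum T f n ((T ^^ m) x)"
proof (induction n)
  case (Suc n)
  have "(T ^^ (m + n)) x = (T ^^ n) ((T ^^ m) x)" by (simp add: funpow_add add.commute[of m])
  then show ?case using Suc by (simp add: birkhoff_sum_Suc)
qed simp

lemma birkhoff_sum_mult_le:
  assumes "\<And>x. birkhoff_sum T f n x \<le> c"
  shows "birkhoff_sum T f (j * n) x \<le> real j * c"
proof (induction j)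
  case (Suc j)
  have "birkhoff_sum T f (Suc j * n) x =
      birkhoff_sum T f (j * n) x + birkhoff_sum T f n ((T ^^ (j * n)) x)"
    using birkhoff_sum_add[of T f "j * n" n x] by (simp add: add.commute)
  then show ?case using Suc assms[of "(T ^^ (j * n)) x"] by (simp add: algebra_simps)
qed simp

lemma birkhoff_sum_period:
  assumes "(T ^^ p) y = y"
  shows "birkhoff_sum T f (j * p) y = real j * birkhoff_sum T f p y"
proof (induction j)
  case (Suc j)
  then show ?case
    using birkhoff_sum_add[of T f p "j * p" y] assms by (simp add: algebra_simps)
qed simp

context uniformly_expanding
begin

lemma birkhoff_sum_diff_le:
  assumes "C-lipschitz_on UNIV f"
  shows "birkhoff_sum T f n x \<le> birkhoff_sum T f n y + C * (\<Sum>k<n. dist ((T ^^ k) x) ((T ^^ k) y))"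
proof -
  have "birkhoff_sum T f n x \<le> (\<Sum>k<n. f ((T ^^ k) y) + C * dist ((T ^^ k) x) ((T ^^ k) y))"
    unfolding birkhoff_sum_def
  proof (rule sum_mono)
    fix k
    show "f ((T ^^ k) x) \<le> f ((T ^^ k) y) + C * dist ((T ^^ k) x) ((T ^^ k) y)"
      using lipschitz_onD[OF assms, of "(T ^^ k) x" "(T ^^ k) y"] by (simp add: dist_real_def)
  qed
  then show ?thesis by (simp add: sum.distrib sum_distrib_left birkhoff_sum_def)
qed

lemma lipschitz_bounded:
  fixes f :: "'a \<Rightarrow> real"
  assumes "C-lipschitz_on UNIV f"
  shows "\<exists>B\<ge>0. \<forall>x. \<bar>f x\<bar> \<le> B"
proof -
  have "compact (range f)"
    by (rule compact_continuous_image[OF lipschitz_on_continuous_on[OF assms] compact_space])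
  then obtain B where "\<And>y. y \<in> range f \<Longrightarrow> \<bar>y\<bar> \<le> B"
    using compact_imp_bounded bounded_real by metis
  then have "\<bar>f x\<bar> \<le> \<bar>B\<bar>" for x using abs_ge_self[of B] by (meson order_trans rangeI)
  then show ?thesis by (intro exI[of _ "\<bar>B\<bar>"]) auto
qed

text \<open>An orbit segment that returns to the same cell of a fine partition is close to a periodic orbit
  and so contributes at most a constant. Cutting at the last visit to the cell of the starting point
  removes that cell for good, and therefore at most as many such loops as there are cells are needed
  to exhaust a segment of any length.\<close>
lemma birkhoff_sum_bounded_above:
  assumes F: "C-lipschitz_on UNIV F"
    and per: "\<And>p y. 1 \<le> p \<Longrightarrow> (T ^^ p) y = y \<Longrightarrow> birkhoff_sum T F p y \<le> 0"
  shows "\<exists>D\<ge>0. \<forall>n x. birkhoff_sum T F n x \<le> D"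
proof -
  obtain B where B: "B \<ge> 0" "\<And>x. \<bar>F x\<bar> \<le> B" using lipschitz_bounded[OF F] by blast
  define \<delta> where "\<delta> = (1 - lam) * rho / 2"
  have "\<delta> > 0" using lam rho by (simp add: \<delta>_def)
  then obtain c :: "'a \<Rightarrow> 'a" where c: "finite (range c)" "\<And>x y. c x = c y \<Longrightarrow> dist x y < \<delta>"
    using finite_partition by blast
  have C: "C \<ge> 0" using lipschitz_on_nonneg[OF F] .
  define E where "E = C * (\<delta> / (1 - lam)^2)"
  have E: "E \<ge> 0" using C \<open>\<delta> > 0\<close> by (simp add: E_def)
  have loop: "birkhoff_sum T F j x \<le> E" if "c ((T ^^ j) x) = c x" for j x
  proof (cases "j = 0")
    case False
    then have d: "dist ((T ^^ j) x) x < \<delta>" "1 \<le> j" using c(2)[OF that] by auto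
    then obtain y where y: "(T ^^ j) y = y"
      "(\<Sum>k<j. dist ((T ^^ k) x) ((T ^^ k) y)) \<le> dist ((T ^^ j) x) x / (1 - lam)^2"
      using closing[of j x] unfolding \<delta>_def by blast
    have "dist ((T ^^ j) x) x / (1 - lam)^2 \<le> \<delta> / (1 - lam)^2"
      using d by (intro divide_right_mono) auto
    then have "C * (\<Sum>k<j. dist ((T ^^ k) x) ((T ^^ k) y)) \<le> E"
      unfolding E_def using y(2) C by (intro mult_left_mono) linarith+
    then show ?thesis
      using birkhoff_sum_diff_le[OF F, of j x y] per[OF d(2) y(1)] by linarith
  qed (use E in simp)
  have "birkhoff_sum T F n x \<le> card Q * (E + B)"
    if "finite Q" "\<And>i. i < n \<Longrightarrow> c ((T ^^ i) x) \<in> Q" for Q n x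
    using that
  proof (induction "card Q" arbitrary: Q n x)
    case 0
    then have "n = 0" by (metis card_0_eq empty_iff gr0I)
    then show ?case using E B(1) by simp
  next
    case (Suc k)
    show ?case
    proof (cases "n = 0")
      case False
      define J where "J = {j. j < n \<and> c ((T ^^ j) x) = c x}"
      have "0 \<in> J" "finite J" using False by (auto simp: J_def)
      then obtain j where j: "j \<in> J" "\<And>i. i \<in> J \<Longrightarrow> i \<le> j"
        using Max_in[of J] Max_ge[of J] by blast
      then have jn: "j < n" "c ((T ^^ j) x) = c x" by (auto simp: J_def)
      have cx: "c x \<in> Q" using Suc.prems(2)[of 0] False by simp
      have "birkhoff_sum T F (n - Suc j) ((T ^^ Suc j) x) \<le> card (Q - {c x}) * (E + B)"
      proof (rule Suc.hyps(1))
        show "k = card (Q - {c x})" using Suc.hyps(2) cx Suc.prems(1) by simp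
        fix i assume i: "i < n - Suc j"
        have "(T ^^ i) ((T ^^ Suc j) x) = (T ^^ (i + Suc j)) x"
          using funpow_add[of i "Suc j" T] by (simp add: o_def)
        moreover have "i + Suc j \<notin> J" using j(2)[of "i + Suc j"] by auto
        ultimately show "c ((T ^^ i) ((T ^^ Suc j) x)) \<in> Q - {c x}"
          using i Suc.prems(2)[of "i + Suc j"] by (simp add: J_def)
      qed (use Suc.prems in simp)
      moreover have "card (Q - {c x}) = k" using Suc.hyps(2) cx Suc.prems(1) by simp
      moreover have "birkhoff_sum T F n x =
        birkhoff_sum T F (Suc j) x + birkhoff_sum T F (n - Suc j) ((T ^^ Suc j) x)"
        using birkhoff_sum_add[of T F "Suc j" "n - Suc j" x] jn by simp
      moreover have "birkhoff_sum T F (Suc j) x \<le> E + B"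
        using loop[OF jn(2)] B(2)[of "(T ^^ j) x"] by (simp add: birkhoff_sum_Suc)
      ultimately show ?thesis using Suc.hyps(2)[symmetric] by (simp add: algebra_simps)
    next
      case True
      have "0 \<le> real (card Q) * (E + B)" using E B(1) by (intro mult_nonneg_nonneg) simp_all
      then show ?thesis using True by simp
    qed
  qed
  from this[OF c(1)] show ?thesis
    using E B by (intro exI[of _ "card (range c) * (E + B)"]) auto
qed

lemma pull_back_orbit:
  assumes "dist ((T ^^ n) y) w < rho"
  shows "\<exists>y'. (T ^^ n) y' = w \<and> (\<forall>k\<le>n. dist ((T ^^ k) y) ((T ^^ k) y') \<le> lam ^ (n - k) * dist ((T ^^ n) y) w)"
  using assms
proof (induction n arbitrary: y)
  case (Suc n)
  define d where "d = dist ((T ^^ Suc n) y) w"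
  have Ty: "(T ^^ n) (T y) = (T ^^ Suc n) y" by (simp add: funpow_swap1)
  obtain v where v: "(T ^^ n) v = w" "\<And>k. k \<le> n \<Longrightarrow> dist ((T ^^ k) (T y)) ((T ^^ k) v) \<le> lam ^ (n - k) * d"
    using Suc.IH[of "T y"] Suc.prems Ty unfolding d_def by auto
  have d0: "dist (T y) v \<le> lam ^ n * d" using v(2)[of 0] by simp
  also have "\<dots> \<le> 1 * d" using lam by (intro mult_right_mono power_le_one) (auto simp: d_def)
  finally obtain y' where y': "T y' = v" "dist y y' \<le> lam * dist (T y) v"
    using branch[of y v] Suc.prems d_def by auto
  have "dist ((T ^^ k) y) ((T ^^ k) y') \<le> lam ^ (Suc n - k) * d" if "k \<le> Suc n" for k
  proof (cases k)
    case 0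
    have "lam * dist (T y) v \<le> lam * (lam ^ n * d)" using d0 lam by (intro mult_left_mono) auto
    then show ?thesis using y' 0 by simp
  next
    case (Suc i)
    then show ?thesis using v(2)[of i] that y'(1) by (simp add: funpow_swap1)
  qed
  moreover have "(T ^^ Suc n) y' = w" using v(1) y'(1) by (simp add: funpow_swap1)
  ultimately show ?case unfolding d_def by blast
qed auto

text \<open>The supremum \<open>h x\<close> of all Birkhoff sums along pasts of \<open>x\<close> is finite by the preceding lemma, and
  prolonging a past by one step gives the inequality. It is Lipschitz because a past of \<open>x\<close> can
  be pulled back to a past of any nearby point, with geometrically decaying distances.\<close>
lemma sub_action:
  assumes F: "C-lipschitz_on UNIV F"
    and per: "\<And>p y. 1 \<le> p \<Longrightarrow> (T ^^ p) y = y \<Longrightarrow> birkhoff_sum T F p y \<le> 0"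
  shows "\<exists>h K. K-lipschitz_on UNIV h \<and> (\<forall>x. F x + h x \<le> h (T x))"
proof -
  obtain D where D: "D \<ge> 0" "\<And>n x. birkhoff_sum T F n x \<le> D"
    using birkhoff_sum_bounded_above[OF assms] by blast
  have C: "C \<ge> 0" using lipschitz_on_nonneg[OF F] .
  define V where "V x = {birkhoff_sum T F n y | n y. (T ^^ n) y = x}" for x
  define h where "h x = Sup (V x)" for x
  have V0: "0 \<in> V x" for x
    unfolding V_def by (rule CollectI, intro exI[of _ 0] exI[of _ x]) simp
  have bdd: "bdd_above (V x)" for x
    using D by (intro bdd_aboveI[of _ D]) (auto simp: V_def)
  have h_ge: "birkhoff_sum T F n y \<le> h ((T ^^ n) y)" for n y
    unfolding h_def by (rule cSup_upper[OF _ bdd]) (auto simp: V_def)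
  have h_le: "h x \<le> b" if "\<And>n y. (T ^^ n) y = x \<Longrightarrow> birkhoff_sum T F n y \<le> b" for x b
  proof -
    have "V x \<noteq> {}" using V0[of x] by blast
    then show ?thesis unfolding h_def by (rule cSup_least) (use that in \<open>auto simp: V_def\<close>)
  qed
  have h0: "0 \<le> h x" for x using h_ge[of 0 x] by simp
  have hD: "h x \<le> D" for x using D(2) by (intro h_le)
  define E where "E = C / (1 - lam)"
  have local: "h x \<le> h x' + E * dist x x'" if d: "dist x x' < rho" for x x'
  proof (rule h_le)
    fix n y assume y: "(T ^^ n) y = x"
    then obtain y' where y': "(T ^^ n) y' = x'"
      "\<And>k. k \<le> n \<Longrightarrow> dist ((T ^^ k) y) ((T ^^ k) y') \<le> lam ^ (n - k) * dist x x'"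
      using pull_back_orbit[of n y x'] d by auto
    have "(\<Sum>k<n. dist ((T ^^ k) y) ((T ^^ k) y')) \<le> (\<Sum>k<n. lam ^ (n - k) * dist x x')"
      using y'(2) by (intro sum_mono) auto
    also have "\<dots> \<le> 1 / (1 - lam) * dist x x'"
      unfolding sum_distrib_right[symmetric]
      by (intro mult_right_mono geometric_sum_reverse_le) auto
    finally have "C * (\<Sum>k<n. dist ((T ^^ k) y) ((T ^^ k) y')) \<le> C * (1 / (1 - lam) * dist x x')"
      using C by (rule mult_left_mono)
    then have "C * (\<Sum>k<n. dist ((T ^^ k) y) ((T ^^ k) y')) \<le> E * dist x x'"
      by (simp add: E_def)
    then show "birkhoff_sum T F n y \<le> h x' + E * dist x x'"
      using birkhoff_sum_diff_le[OF F, of n y y'] h_ge[of n y'] y'(1) by simp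
  qed
  define K where "K = max E (D / rho)"
  have K: "h x \<le> h x' + K * dist x x'" for x x'
  proof (cases "dist x x' < rho")
    case True
    have "E * dist x x' \<le> K * dist x x'" by (intro mult_right_mono) (auto simp: K_def)
    then show ?thesis using local[OF True] by linarith
  next
    case False
    then have "D / rho * rho \<le> K * dist x x'"
      using D rho by (intro mult_mono) (auto simp: K_def le_max_iff_disj)
    then show ?thesis using hD[of x] h0[of x'] rho by simp
  qed
  have "K-lipschitz_on UNIV h"
  proof (rule lipschitz_onI)
    show "0 \<le> K" using D rho by (auto simp: K_def le_max_iff_disj)
    show "dist (h x) (h y) \<le> K * dist x y" for x y
      using K[of x y] K[of y x] by (auto simp: dist_real_def dist_commute)
  qed
  moreover have "F x + h x \<le> h (T x)" for x
  proof -
    have "h x \<le> h (T x) - F x"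
    proof (rule h_le)
      fix n y assume "(T ^^ n) y = x"
      then show "birkhoff_sum T F n y \<le> h (T x) - F x"
        using h_ge[of "Suc n" y] by (simp add: birkhoff_sum_Suc)
    qed
    then show ?thesis by linarith
  qed
  ultimately show ?thesis by blast
qed

text \<open>If all Birkhoff sums of some fixed length were at most some negative constant, then the averages over
  periodic orbits would be bounded away from \<open>0\<close>. So there are orbit segments of any length on which \<open>g\<close> is
  nearly \<open>0\<close>, and a limit of their starting points has the desired property.\<close>
lemma maximizing_set_nonempty:
  assumes g: "continuous_on UNIV g" and nonpos: "\<And>x. g x \<le> 0"
    and per: "\<And>\<eta>. \<eta> > 0 \<Longrightarrow> \<exists>p y. 1 \<le> p \<and> (T ^^ p) y = y \<and> birkhoff_sum T g p y > - \<eta> * real p"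
  shows "\<exists>z. \<forall>k. g ((T ^^ k) z) = 0"
proof -
  have ex: "\<exists>x. birkhoff_sum T g N x > - c" if "N \<ge> 1" "c > 0" for N and c :: real
  proof (rule ccontr)
    assume "\<not> ?thesis"
    then have le: "birkhoff_sum T g N x \<le> - c" for x by (auto simp: not_less)
    have cN: "c / N > 0" using that by simp
    obtain p y where p: "1 \<le> p" "(T ^^ p) y = y" "birkhoff_sum T g p y > - (c / N) * real p"
      using per[of "c / N"] cN by blast
    have "real N * birkhoff_sum T g p y \<le> real p * (- c)"
      using birkhoff_sum_mult_le[OF le, of p y] birkhoff_sum_period[OF p(2), where j = N]
      by (simp add: mult.commute)
    moreover have "real N * birkhoff_sum T g p y > real N * (- (c / N) * real p)"
      using p(3) that by (intro mult_strict_left_mono) auto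
    ultimately show False using that by (simp add: field_simps)
  qed
  have "\<exists>x. birkhoff_sum T g (Suc N) x > - (1 / real (Suc N))" for N
    using ex[of "Suc N" "1 / real (Suc N)"] by simp
  then obtain x where x: "\<And>N. birkhoff_sum T g (Suc N) (x N) > - (1 / real (Suc N))" by metis
  have gx: "g ((T ^^ k) (x N)) \<ge> - (1 / real (Suc N))" if "k \<le> N" for k N
  proof -
    have "(\<Sum>k<Suc N. - g ((T ^^ k) (x N))) \<ge> - g ((T ^^ k) (x N))"
      using that nonpos by (intro member_le_sum) auto
    then show ?thesis using x[of N] by (simp add: birkhoff_sum_def sum_negf)
  qed
  obtain z r where r: "strict_mono (r :: nat \<Rightarrow> nat)" "(\<lambda>n. x (r n)) \<longlonglongrightarrow> z"
    by (rule subsequential_limit)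
  have "g ((T ^^ k) z) \<ge> 0" for k
  proof (rule LIMSEQ_le)
    show "(\<lambda>n. g ((T ^^ k) (x (r n)))) \<longlonglongrightarrow> g ((T ^^ k) z)"
      using r(2) by (intro continuous_on_tendsto_compose[OF g] continuous_on_tendsto_compose[OF continuous_on_iterate[of UNIV]]) auto
    have "(\<lambda>n. - (1 / real (Suc n))) \<longlonglongrightarrow> - 0"
      using LIMSEQ_inverse_real_of_nat by (intro tendsto_minus) (simp add: inverse_eq_divide)
    then show "(\<lambda>n. - (1 / real (Suc (r n)))) \<longlonglongrightarrow> 0"
      using LIMSEQ_subseq_LIMSEQ[OF _ r(1)] by (fastforce simp: o_def)
    show "\<exists>N. \<forall>n\<ge>N. - (1 / real (Suc (r n))) \<le> g ((T ^^ k) (x (r n)))"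
      using gx seq_suble[OF r(1)] le_trans by blast
  qed
  then show ?thesis using nonpos by (metis order_antisym)
qed

text \<open>Here \<open>\<beta>\<close> is the supremum of the averages of \<open>f\<close> over periodic orbits. Defining it in this
  way, rather than through invariant measures, lets the closing lemma do the work of
  existence theorems for maximizing measures.\<close>
lemma normal_form:
  fixes f :: "'a \<Rightarrow> real"
  assumes f: "C-lipschitz_on UNIV f"
  shows "\<exists>\<beta> h K Z. K-lipschitz_on UNIV h \<and> Z \<noteq> {} \<and> T ` Z \<subseteq> Z \<and>
    (\<forall>x. f x - \<beta> + h x - h (T x) \<le> 0) \<and> (\<forall>z\<in>Z. f z - \<beta> + h z - h (T z) = 0)"
proof -
  obtain B where B: "B \<ge> 0" "\<And>x. \<bar>f x\<bar> \<le> B" using lipschitz_bounded[OF f] by blast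
  define S where "S = {birkhoff_sum T f p y / p | p y. 1 \<le> p \<and> (T ^^ p) y = y}"
  define \<beta> where "\<beta> = Sup S"
  obtain p y where "1 \<le> p" "(T ^^ p) y = y"
    using superpolynomial_approximation[of UNIV 1 0] by auto
  then have ne: "S \<noteq> {}" by (auto simp: S_def)
  have bdd: "bdd_above S"
  proof (rule bdd_aboveI)
    fix s assume "s \<in> S"
    then obtain p y where p: "1 \<le> p" "s = birkhoff_sum T f p y / p" by (auto simp: S_def)
    have "birkhoff_sum T f p y \<le> real (card {..<p}) * B"
      unfolding birkhoff_sum_def using B(2) by (intro sum_bounded_above) (auto simp: abs_le_iff)
    then show "s \<le> B" using p by (simp add: divide_le_eq mult.commute)
  qed
  define F where "F x = f x - \<beta>" for x
  have F: "C-lipschitz_on UNIV F"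
    using f unfolding F_def lipschitz_on_def by (simp add: dist_real_def)
  have sumF: "birkhoff_sum T F n x = birkhoff_sum T f n x - n * \<beta>" for n x
    by (simp add: birkhoff_sum_def F_def sum_subtractf)
  have perF: "birkhoff_sum T F p y \<le> 0" if "1 \<le> p" "(T ^^ p) y = y" for p y
  proof -
    have "birkhoff_sum T f p y / p \<le> \<beta>"
      unfolding \<beta>_def using that by (intro cSup_upper[OF _ bdd]) (auto simp: S_def)
    then show ?thesis using that by (simp add: sumF field_simps)
  qed
  obtain h K where h: "K-lipschitz_on UNIV h" "\<And>x. F x + h x \<le> h (T x)"
    using sub_action[OF F perF] by blast
  define g where "g x = F x + h x - h (T x)" for x
  have sumg: "birkhoff_sum T g n x = birkhoff_sum T F n x + h x - h ((T ^^ n) x)" for n x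
    by (induction n) (auto simp: birkhoff_sum_Suc g_def)
  have contT: "continuous_on UNIV T" using continuous_on_iterate[of UNIV 1] by simp
  have conth: "continuous_on UNIV h" by (rule lipschitz_on_continuous_on[OF h(1)])
  have nonpos: "g x \<le> 0" for x using h(2)[of x] by (simp add: g_def)
  have contg: "continuous_on UNIV g"
    unfolding g_def
    by (intro continuous_intros conth lipschitz_on_continuous_on[OF F]
        continuous_on_compose2[OF conth contT]) auto
  have perg: "\<exists>p y. 1 \<le> p \<and> (T ^^ p) y = y \<and> birkhoff_sum T g p y > - \<eta> * real p"
    if "\<eta> > 0" for \<eta> :: real
  proof -
    have "\<beta> - \<eta> < Sup S" using that by (simp add: \<beta>_def)
    then obtain s where "s \<in> S" "\<beta> - \<eta> < s" using less_cSupE[OF _ ne] by blast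
    then obtain p y where p: "1 \<le> p" "(T ^^ p) y = y" "\<beta> - \<eta> < birkhoff_sum T f p y / p"
      by (auto simp: S_def)
    then have "birkhoff_sum T g p y > - \<eta> * real p"
      by (simp add: sumg sumF field_simps)
    then show ?thesis using p by blast
  qed
  obtain z where z: "\<And>k. g ((T ^^ k) z) = 0"
    using maximizing_set_nonempty[OF contg nonpos perg] by blast
  define Z where "Z = range (\<lambda>k. (T ^^ k) z)"
  have "T ` Z \<subseteq> Z"
  proof
    fix x assume "x \<in> T ` Z"
    then obtain k where "x = (T ^^ Suc k) z" by (auto simp: Z_def)
    then show "x \<in> Z" unfolding Z_def by blast
  qed
  moreover have "Z \<noteq> {}" "\<forall>x\<in>Z. g x = 0" using z by (auto simp: Z_def)
  ultimately show ?thesis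
    using h unfolding g_def F_def
    by (intro exI[of _ \<beta>] exI[of _ h] exI[of _ K] exI[of _ Z]) (auto simp: algebra_simps)
qed

end

section \<open>Locking on a periodic orbit\<close>

context uniformly_expanding
begin

text \<open>Let \<open>u\<close> be the point of the periodic orbit \<open>S\<close> nearest to \<open>x\<close>, and compare the orbits of \<open>x\<close> and \<open>u\<close>.
  As long as their distance is less than \<open>r'\<close>, the Birkhoff sum of \<open>v\<close> along \<open>x\<close> is compared with that
  along \<open>u\<close>; the distances sum up to at most \<open>r' / (1 - lam)\<close>, and over full periods the sum along \<open>u\<close>
  agrees with its mean, so only the last, incomplete period contributes, at most \<open>p * b\<close>. While the distance is between \<open>r'\<close> and \<open>r\<close>, every term is nonpositive.
  Then the distance reaches \<open>r\<close>, and the penalty \<open>\<epsilon> * r\<close> of this one time cancels everything gained before.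
  The condition that \<open>(1 + L) * r\<close> is at most the gap \<open>\<gamma>\<close> makes sure that the orbit is then also far
  from all other points of \<open>S\<close>. From there on the argument starts afresh, hence the strong induction.\<close>
lemma birkhoff_sum_locked:
  fixes v :: "'a \<Rightarrow> real" and y :: 'a and p :: nat and \<gamma> vbar b r r' \<epsilon> :: real
  defines "S \<equiv> (\<lambda>k. (T ^^ k) y) ` {..<p}"
  assumes p: "1 \<le> p" "(T ^^ p) y = y"
    and gap: "\<And>i j. i < j \<Longrightarrow> j < p \<Longrightarrow> \<gamma> \<le> dist ((T ^^ i) y) ((T ^^ j) y)"
    and v: "C-lipschitz_on UNIV v"
    and top: "\<And>x. v x \<le> vbar + b" and b: "0 \<le> b"
    and vbar: "birkhoff_sum T v p y = p * vbar"
    and r: "0 < r'" "r' \<le> r" "r \<le> rho" "(1 + L) * r \<le> \<gamma>"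
    and \<epsilon>: "b \<le> \<epsilon> * r'" "(p + 1) * b + C * r' / (1 - lam) \<le> \<epsilon> * r" "0 \<le> \<epsilon>"
  shows "birkhoff_sum T (\<lambda>x. v x - vbar - \<epsilon> * infdist x S) n x \<le> p * b + C * r' / (1 - lam)"
proof (induction n arbitrary: x rule: less_induct)
  case (less n)
  define G where "G x = v x - vbar - \<epsilon> * infdist x S" for x
  define A where "A = p * b + C * r' / (1 - lam)"
  have C: "0 \<le> C" using lipschitz_on_nonneg[OF v] .
  have A: "0 \<le> A" using C b r lam by (simp add: A_def)
  have S_ne: "S \<noteq> {}" "finite S"
    using p by (auto simp: S_def lessThan_empty_iff bot_nat_def)
  have orbit_in: "(T ^^ k) y \<in> S" for k
    using funpow_periodic(2)[OF p(2), of k] mod_less_divisor[of p k] p unfolding S_def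
    by (metis One_nat_def Suc_le_eq image_eqI lessThan_iff)
  have sep: "\<gamma> \<le> dist u w" if "u \<in> S" "w \<in> S" "u \<noteq> w" for u w
  proof -
    obtain i j where "i < p" "j < p" "u = (T ^^ i) y" "w = (T ^^ j) y"
      using \<open>u \<in> S\<close> \<open>w \<in> S\<close> unfolding S_def by blast
    then show ?thesis using gap[of i j] gap[of j i] \<open>u \<noteq> w\<close>
      by (cases i j rule: linorder_cases) (auto simp: dist_commute)
  qed
  have infdist_ge: "min (dist x u) (\<gamma> - dist x u) \<le> infdist x S" if "u \<in> S" for x u
  proof -
    have "min (dist x u) (\<gamma> - dist x u) \<le> dist x w" if "w \<in> S" for w
      using sep[OF \<open>u \<in> S\<close> that] dist_triangle3[of u w x] by (cases "u = w") auto
    then show ?thesis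
      unfolding infdist_def using S_ne by (auto intro!: cINF_greatest)
  qed
  have G_top: "G x \<le> b - \<epsilon> * infdist x S" for x using top[of x] by (simp add: G_def)
  obtain u where u: "u \<in> S" "infdist x S = dist x u"
  proof -
    have "infdist x S = Min (dist x ` S)"
      using S_ne by (simp add: infdist_def cInf_eq_Min)
    then have "infdist x S \<in> dist x ` S"
      using S_ne Min_in[of "dist x ` S"] by simp
    then show ?thesis using that by blast
  qed
  then obtain a where a: "u = (T ^^ a) y" by (auto simp: S_def)
  have Tu: "(T ^^ k) u \<in> S" for k
    using orbit_in[of "k + a"] by (simp add: a funpow_add)
  have up: "(T ^^ p) u = u"
    using funpow_periodic(1)[OF p(2), of a] funpow_add[of p a T] by (simp add: a add.commute)
  define e where "e k = dist ((T ^^ k) x) ((T ^^ k) u)" for k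
  have e_step: "e k \<le> lam * e (Suc k)" if "e k < r" for k
    using expand[of "(T ^^ k) x" "(T ^^ k) u"] that r by (simp add: e_def)
  have e_mono: "e j \<le> e k" if "j \<le> k" "\<And>i. i < k \<Longrightarrow> e i < r" for j k
    using that
  proof (induction k)
    case (Suc k)
    have "lam * e (Suc k) \<le> 1 * e (Suc k)"
      using lam by (intro mult_right_mono) (auto simp: e_def)
    then have "e k \<le> e (Suc k)" using e_step[of k] Suc.prems(2)[of k] by simp
    then show ?case using Suc by (cases "j = Suc k") (auto intro: order_trans)
  qed simp
  have e_infdist: "e k \<le> infdist ((T ^^ k) x) S" if "e k < r" for k
  proof -
    have "2 * r \<le> (1 + L) * r" using L r by (intro mult_right_mono) auto
    then have "e k \<le> \<gamma> - e k" using that r by linarith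
    then show ?thesis using infdist_ge[OF Tu[of k], of "(T ^^ k) x"] by (simp add: e_def)
  qed
  have follow: "birkhoff_sum T G n x \<le> A" if near: "\<And>k. k < n \<Longrightarrow> e k < r'" for n
  proof -
    have "G z \<le> v z - vbar" for z using \<epsilon>(3) by (simp add: G_def infdist_nonneg)
    then have "birkhoff_sum T G n x \<le> birkhoff_sum T (\<lambda>z. v z - vbar) n x"
      unfolding birkhoff_sum_def by (intro sum_mono)
    also have "\<dots> = birkhoff_sum T v n x - n * vbar"
      by (simp add: birkhoff_sum_def sum_subtractf)
    also have "\<dots> \<le> birkhoff_sum T v n u - n * vbar + C * (\<Sum>k<n. e k)"
      using birkhoff_sum_diff_le[OF v, of n x u] by (simp add: e_def)
    finally have "birkhoff_sum T G n x \<le> birkhoff_sum T v n u - n * vbar + C * (\<Sum>k<n. e k)" .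
    moreover have "C * (\<Sum>k<n. e k) \<le> C * (r' / (1 - lam))"
    proof (rule mult_left_mono[OF _ C])
      have "(\<Sum>k<n. e k) \<le> (\<Sum>k<n. lam ^ (n - Suc k) * r')"
      proof (rule sum_mono)
        fix k assume k: "k \<in> {..<n}"
        have "e k \<le> lam ^ (n - Suc k) * e (k + (n - Suc k))"
          unfolding e_def funpow_add[of _ k] add.commute[of k] o_apply
        proof (rule expand_iterate)
          fix i assume "i < n - Suc k"
          then have "e (i + k) < r'" by (intro near) auto
          then show "dist ((T ^^ i) ((T ^^ k) x)) ((T ^^ i) ((T ^^ k) u)) < rho"
            using r by (simp add: e_def funpow_add)
        qed
        also have "k + (n - Suc k) = n - 1" using k by auto
        also have "lam ^ (n - Suc k) * e (n - 1) \<le> lam ^ (n - Suc k) * r'"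
          using near[of "n - 1"] k lam by (intro mult_left_mono) auto
        finally show "e k \<le> lam ^ (n - Suc k) * r'" .
      qed
      also have "\<dots> = (\<Sum>k<n. lam ^ k) * r'"
        by (simp add: sum.nat_diff_reindex[of "\<lambda>k. lam ^ k * r'"] sum_distrib_right)
      also have "\<dots> \<le> 1 / (1 - lam) * r'"
        using geometric_sum_le r by (intro mult_right_mono) auto
      finally show "(\<Sum>k<n. e k) \<le> r' / (1 - lam)" by simp
    qed
    moreover have "birkhoff_sum T v n u - n * vbar \<le> p * b"
    proof -
      define s where "s = n mod p"
      have s: "s \<le> p" "n = n div p * p + s" using p by (auto simp: s_def intro: less_imp_le)
      have "(T ^^ (n div p * p)) u = u"
        using funpow_mod_eq[OF up, of "n div p * p"] by simp
      then have "birkhoff_sum T v n u = real (n div p) * birkhoff_sum T v p u + birkhoff_sum T v s u"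
        using birkhoff_sum_add[of T v "n div p * p" s u] birkhoff_sum_period[OF up] s(2) by metis
      moreover have "birkhoff_sum T v p u = p * vbar"
        using sum_over_period[OF p(2), of v a] vbar by (simp add: birkhoff_sum_def a)
      moreover have "birkhoff_sum T v s u \<le> real (card {..<s}) * (vbar + b)"
        unfolding birkhoff_sum_def using top by (intro sum_bounded_above)
      moreover have "real n = real (n div p) * p + s" using s(2) by (metis of_nat_add of_nat_mult)
      moreover have "s * b \<le> p * b" using s b by (intro mult_right_mono) auto
      ultimately show ?thesis by (simp add: algebra_simps)
    qed
    ultimately show ?thesis by (simp add: A_def)
  qed
  have small: "G ((T ^^ k) x) \<le> 0" if "e k < r" "r' \<le> e k" for k
  proof -
    have "\<epsilon> * r' \<le> \<epsilon> * infdist ((T ^^ k) x) S"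
      using e_infdist[OF that(1)] that(2) \<epsilon>(3) by (intro mult_left_mono) auto
    then show ?thesis using G_top[of "(T ^^ k) x"] \<epsilon>(1) by linarith
  qed
  have before: "birkhoff_sum T G n x \<le> A" if "\<And>k. k < n \<Longrightarrow> e k < r" for n
    using that
  proof (induction n)
    case (Suc n)
    show ?case
    proof (cases "e n < r'")
      case True
      have "e k < r'" if "k < Suc n" for k
        using e_mono[of k n] that Suc.prems True by force
      then show ?thesis by (rule follow)
    next
      case False
      then show ?thesis using Suc small[of n] by (simp add: birkhoff_sum_Suc)
    qed
  qed (use A in simp)
  show "birkhoff_sum T G n x \<le> A"
  proof (cases "\<forall>k<n. e k < r")
    case True
    then show ?thesis using before by blast
  next
    case False
    define m where "m = (LEAST k. \<not> e k < r)"
    have m: "\<not> e m < r" unfolding m_def using False by (metis LeastI)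
    have below: "e k < r" if "k < m" for k using that not_less_Least unfolding m_def by blast
    have "m < n" using False Least_le[of "\<lambda>k. \<not> e k < r"] unfolding m_def by (meson le_less_trans)
    have "r \<le> infdist ((T ^^ m) x) S"
    proof (cases m)
      case 0
      then show ?thesis using u m by (simp add: e_def)
    next
      case (Suc k)
      have "e m \<le> L * e k" unfolding e_def Suc by (simp add: lipschitz)
      also have "\<dots> \<le> L * r" using below[of k] Suc L by (intro mult_left_mono) auto
      finally have "r \<le> \<gamma> - e m" using r by (simp add: algebra_simps)
      then show ?thesis using infdist_ge[OF Tu[of m], of "(T ^^ m) x"] m by (simp add: e_def)
    qed
    then have "\<epsilon> * r \<le> \<epsilon> * infdist ((T ^^ m) x) S" using \<epsilon>(3) by (rule mult_left_mono)
    then have "G ((T ^^ m) x) \<le> b - \<epsilon> * r" using G_top[of "(T ^^ m) x"] by linarith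
    moreover have "A + b \<le> \<epsilon> * r" using \<epsilon>(2) by (simp add: A_def algebra_simps)
    ultimately have "birkhoff_sum T G (Suc m) x \<le> 0"
      using before[of m] below by (simp add: birkhoff_sum_Suc)
    moreover have "birkhoff_sum T G (n - Suc m) ((T ^^ Suc m) x) \<le> A"
      unfolding G_def A_def using \<open>m < n\<close> by (intro less.IH) auto
    ultimately show ?thesis
      using birkhoff_sum_add[of T G "Suc m" "n - Suc m" x] \<open>m < n\<close> by simp
  qed
qed

end

section \<open>Invariant measures carried by a periodic orbit\<close>

text \<open>The uniform distribution is taken on the times rather than on the points, so that no case
  distinction is needed when \<open>p\<close> is a multiple of the least period.\<close>
definition orbit_measure :: "('a::metric_space \<Rightarrow> 'a) \<Rightarrow> nat \<Rightarrow> 'a \<Rightarrow> 'a measure" where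
  "orbit_measure T p y = distr (measure_pmf (pmf_of_set {..<p})) borel (\<lambda>k. (T ^^ k) y)"

lemma integral_orbit_measure:
  assumes "1 \<le> p" "f \<in> borel_measurable borel"
  shows "integral\<^sup>L (orbit_measure T p y) f = birkhoff_sum T f p y / p"
proof -
  have ne: "{..<p} \<noteq> {}" using assms(1) by (auto simp: lessThan_empty_iff bot_nat_def)
  have "integral\<^sup>L (orbit_measure T p y) f =
      integral\<^sup>L (measure_pmf (pmf_of_set {..<p})) (\<lambda>k. f ((T ^^ k) y))"
    unfolding orbit_measure_def using assms(2) by (intro integral_distr) auto
  also have "\<dots> = birkhoff_sum T f p y / p"
    using integral_pmf_of_set[OF ne] by (simp add: birkhoff_sum_def)
  finally show ?thesis .
qed

lemma orbit_measure_invariant: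
  assumes p: "1 \<le> p" "(T ^^ p) y = y" and T: "T \<in> borel_measurable borel"
  shows "orbit_measure T p y \<in> invariant_measures T"
proof -
  define g where "g k = (T ^^ k) y" for k
  define q where "q = pmf_of_set {..<p}"
  have g: "g \<in> measurable (measure_pmf q) borel" "g \<in> measurable (count_space UNIV) borel" by auto
  have O: "orbit_measure T p y = distr (measure_pmf q) borel g"
    by (simp add: orbit_measure_def g_def[abs_def] q_def)
  have prob: "prob_space (orbit_measure T p y)"
    unfolding O by (intro measure_pmf.prob_space_distr g)
  have inj: "inj_on (\<lambda>k. Suc k mod p) {..<p}"
  proof (rule inj_onI)
    fix i j assume "i \<in> {..<p}" "j \<in> {..<p}" "Suc i mod p = Suc j mod p"
    then show "i = j" by (cases "Suc i = p"; cases "Suc j = p") auto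
  qed
  have "(\<lambda>k. Suc k mod p) ` {..<p} = {..<p}"
    using p by (intro endo_inj_surj inj) auto
  then have "bij_betw (\<lambda>k. Suc k mod p) {..<p} {..<p}" using inj by (simp add: bij_betw_def)
  then have q: "map_pmf (\<lambda>k. Suc k mod p) q = q"
    unfolding q_def using p
    by (intro map_pmf_of_set_bij_betw) (auto simp: lessThan_empty_iff bot_nat_def)
  have "g \<circ> (\<lambda>k. Suc k mod p) = T \<circ> g"
    using funpow_mod_eq[OF p(2)] by (auto simp: g_def)
  moreover have "distr (measure_pmf q) borel (T \<circ> g) = distr (distr (measure_pmf q) borel g) borel T"
    by (rule distr_distr[OF T g(1), symmetric])
  moreover have "distr (measure_pmf q) borel (g \<circ> (\<lambda>k. Suc k mod p)) =
      distr (distr (measure_pmf q) (count_space UNIV) (\<lambda>k. Suc k mod p)) borel g"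
    by (rule distr_distr[OF g(2), symmetric]) auto
  ultimately have "distr (orbit_measure T p y) borel T = orbit_measure T p y"
    using q unfolding O by (metis map_pmf_rep_eq)
  then show ?thesis using prob unfolding invariant_measures_def by (simp add: O)
qed

lemma measure_orbit_measure:
  assumes "1 \<le> p"
  shows "measure (orbit_measure T p y) ((\<lambda>k. (T ^^ k) y) ` {..<p}) = 1"
proof -
  define S where "S = (\<lambda>k. (T ^^ k) y) ` {..<p}"
  have S: "S \<in> sets borel" unfolding S_def by (intro borel_closed finite_imp_closed) auto
  have "integral\<^sup>L (orbit_measure T p y) (indicator S) = (1 :: real)"
    using assms S by (subst integral_orbit_measure) (auto simp: birkhoff_sum_def S_def)
  then show ?thesis using S by (simp add: S_def orbit_measure_def)
qed

text \<open>Invariance gives \<open>\<nu> {z} \<le> \<nu> {T z}\<close>, and going once around the orbit all these masses are equal.\<close>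
lemma invariant_measure_of_orbit_unique:
  fixes T :: "'a::metric_space \<Rightarrow> 'a"
  assumes T: "T \<in> borel_measurable borel" and p: "(T ^^ p) y = y"
  defines "S \<equiv> (\<lambda>k. (T ^^ k) y) ` {..<p}"
  assumes \<mu>: "\<mu> \<in> invariant_measures T" "measure \<mu> S = 1"
    and \<nu>: "\<nu> \<in> invariant_measures T" "measure \<nu> S = 1"
  shows "\<mu> = \<nu>"
proof -
  have finS: "finite S" by (simp add: S_def)
  have key: "measure \<nu> A = card (A \<inter> S) / card S"
    if \<nu>: "\<nu> \<in> invariant_measures T" "measure \<nu> S = 1" and A: "A \<in> sets borel" for \<nu> A
  proof -
    interpret prob_space \<nu> using \<nu> by (simp add: invariant_measures_def)
    have sets: "sets \<nu> = sets borel" and inv: "distr \<nu> borel T = \<nu>"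
      using \<nu> by (auto simp: invariant_measures_def)
    have space: "space \<nu> = UNIV" using sets_eq_imp_space_eq[OF sets] by simp
    have T': "T \<in> measurable \<nu> borel" using T measurable_cong_sets[OF sets refl] by blast
    have fin_sets: "B \<in> sets \<nu>" if "finite B" for B
      unfolding sets using that by (intro borel_closed finite_imp_closed)
    have step: "measure \<nu> {z} \<le> measure \<nu> {T z}" for z
    proof -
      have "measure \<nu> {z} \<le> measure \<nu> (T -` {T z} \<inter> space \<nu>)"
      proof (rule finite_measure_mono)
        show "T -` {T z} \<inter> space \<nu> \<in> sets \<nu>" by (rule measurable_sets[OF T']) simp
      qed (auto simp: space)
      also have "\<dots> = measure (distr \<nu> borel T) {T z}"
        using T' by (intro measure_distr[symmetric]) auto
      finally show ?thesis by (simp add: inv)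
    qed
    have mono: "measure \<nu> {(T ^^ i) y} \<le> measure \<nu> {(T ^^ (i + j)) y}" for i j
      by (induction j) (auto intro: order_trans[OF _ step])
    have eq: "measure \<nu> {x} = measure \<nu> {y}" if x: "x \<in> S" for x
    proof -
      obtain k where "k < p" "x = (T ^^ k) y" using x by (auto simp: S_def)
      then show ?thesis using mono[of 0 k] mono[of k "p - k"] p by simp
    qed
    have sum: "measure \<nu> (B \<inter> S) = card (B \<inter> S) * measure \<nu> {y}" for B
    proof -
      have "measure \<nu> (B \<inter> S) = (\<Sum>x\<in>B \<inter> S. measure \<nu> {x})"
        using finS fin_sets by (intro finite_measure_eq_sum_singleton) auto
      also have "\<dots> = (\<Sum>x\<in>B \<inter> S. measure \<nu> {y})" using eq by (intro sum.cong) auto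
      finally show ?thesis by simp
    qed
    have S1: "card S * measure \<nu> {y} = 1" using sum[of S] \<nu>(2) by simp
    have "measure \<nu> A = measure \<nu> (A \<inter> S) + measure \<nu> (A - S)"
      using A fin_sets[OF finS] sets by (metis Int_Diff_disjoint Int_Diff_Un finite_measure_Union sets.Diff sets.Int)
    moreover have "measure \<nu> (A - S) \<le> measure \<nu> (space \<nu> - S)"
    proof (rule finite_measure_mono)
      show "space \<nu> - S \<in> sets \<nu>" using fin_sets[OF finS] by (rule sets.compl_sets)
    qed (auto simp: space)
    moreover have "measure \<nu> (space \<nu> - S) = 0"
      using prob_compl[OF fin_sets[OF finS]] \<nu>(2) by simp
    ultimately have "measure \<nu> A = measure \<nu> (A \<inter> S)"
      using measure_nonneg[of \<nu> "A - S"] by linarith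
    also have "\<dots> = card (A \<inter> S) / card S"
      using sum[of A] S1 by (cases "card S = 0") (auto simp: field_simps)
    finally show ?thesis .
  qed
  interpret M: prob_space \<mu> using \<mu> by (simp add: invariant_measures_def)
  interpret N: prob_space \<nu> using \<nu> by (simp add: invariant_measures_def)
  show ?thesis
  proof (rule measure_eqI)
    show sets: "sets \<mu> = sets \<nu>" using \<mu> \<nu> by (simp add: invariant_measures_def)
    fix A assume "A \<in> sets \<mu>"
    then have "A \<in> sets borel" using \<mu> by (simp add: invariant_measures_def)
    then show "emeasure \<mu> A = emeasure \<nu> A"
      using key[OF \<mu>] key[OF \<nu>] by (simp add: M.emeasure_eq_measure N.emeasure_eq_measure)
  qed
qed

lemma invariant_integrable:
  fixes f :: "'a::metric_space \<Rightarrow> real"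
  assumes "compact (UNIV :: 'a set)" "\<nu> \<in> invariant_measures T" "continuous_on UNIV f"
  shows "integrable \<nu> f"
proof -
  interpret prob_space \<nu> using assms(2) by (simp add: invariant_measures_def)
  have sets: "sets \<nu> = sets borel" using assms(2) by (simp add: invariant_measures_def)
  have "compact (range f)" by (rule compact_continuous_image[OF assms(3,1)])
  then obtain B where "\<And>y. y \<in> range f \<Longrightarrow> \<bar>y\<bar> \<le> B"
    using compact_imp_bounded bounded_real by metis
  then have "AE x in \<nu>. norm (f x) \<le> B" by auto
  moreover have "f \<in> borel_measurable \<nu>"
    using borel_measurable_continuous_onI[OF assms(3)] measurable_cong_sets[OF sets refl] by blast
  ultimately show ?thesis by (rule integrable_const_bound)
qed

lemma invariant_integral_comp:
  fixes f :: "'a::metric_space \<Rightarrow> real"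
  assumes "\<nu> \<in> invariant_measures T" "T \<in> borel_measurable borel" "f \<in> borel_measurable borel"
  shows "integral\<^sup>L \<nu> (\<lambda>x. f (T x)) = integral\<^sup>L \<nu> f"
proof -
  have sets: "sets \<nu> = sets borel" and inv: "distr \<nu> borel T = \<nu>"
    using assms by (auto simp: invariant_measures_def)
  have "T \<in> measurable \<nu> borel" using assms(2) measurable_cong_sets[OF sets refl] by blast
  then show ?thesis using integral_distr[of T \<nu> borel f] assms(3) inv by simp
qed

text \<open>Maximality forces the integral of the distance to \<open>S\<close> to vanish, hence the measure to be carried
  by \<open>S\<close>.\<close>
lemma unique_maximizing_measure:
  fixes T :: "'a::metric_space \<Rightarrow> 'a"
  assumes comp: "compact (UNIV :: 'a set)" and T: "T \<in> borel_measurable borel"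
    and p: "1 \<le> p" "(T ^^ p) y = y"
  defines "S \<equiv> (\<lambda>k. (T ^^ k) y) ` {..<p}"
  assumes \<epsilon>: "\<epsilon> > 0"
    and le: "\<And>\<nu>. \<nu> \<in> invariant_measures T \<Longrightarrow>
      integral\<^sup>L \<nu> F \<le> c - \<epsilon> * integral\<^sup>L \<nu> (\<lambda>x. infdist x S)"
    and attained: "integral\<^sup>L (orbit_measure T p y) F = c"
  shows "{\<nu>. maximizing_measure T F \<nu>} = {orbit_measure T p y}"
proof -
  define \<mu> where "\<mu> = orbit_measure T p y"
  have \<mu>: "\<mu> \<in> invariant_measures T" unfolding \<mu>_def by (rule orbit_measure_invariant[OF p T])
  have \<mu>S: "measure \<mu> S = 1" unfolding \<mu>_def S_def by (rule measure_orbit_measure[OF p(1)])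
  have nonneg: "0 \<le> integral\<^sup>L \<nu> (\<lambda>x. infdist x S)" for \<nu>
    by (intro integral_nonneg_AE) (simp add: infdist_nonneg)
  have le_c: "integral\<^sup>L \<nu> F \<le> c" if "\<nu> \<in> invariant_measures T" for \<nu>
    using le[OF that] mult_nonneg_nonneg[OF less_imp_le[OF \<epsilon>] nonneg[of \<nu>]] by linarith
  have sup: "(SUP \<nu>\<in>invariant_measures T. integral\<^sup>L \<nu> F) = c"
  proof (rule antisym)
    show "(SUP \<nu>\<in>invariant_measures T. integral\<^sup>L \<nu> F) \<le> c"
      using \<mu> le_c by (intro cSUP_least) auto
    have "bdd_above ((\<lambda>\<nu>. integral\<^sup>L \<nu> F) ` invariant_measures T)"
      using le_c by (intro bdd_aboveI2) auto
    then show "c \<le> (SUP \<nu>\<in>invariant_measures T. integral\<^sup>L \<nu> F)"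
      using cSUP_upper[OF \<mu>] attained \<mu>_def by metis
  qed
  have finS: "finite S" "S \<noteq> {}"
    using p by (auto simp: S_def lessThan_empty_iff bot_nat_def)
  have "\<nu> = \<mu>" if "maximizing_measure T F \<nu>" for \<nu>
  proof -
    have \<nu>: "\<nu> \<in> invariant_measures T" and "integral\<^sup>L \<nu> F = c"
      using that sup by (auto simp: maximizing_measure_def)
    then have "\<epsilon> * integral\<^sup>L \<nu> (\<lambda>x. infdist x S) \<le> 0" using le[OF \<nu>] by linarith
    then have "integral\<^sup>L \<nu> (\<lambda>x. infdist x S) = 0"
      using \<epsilon> nonneg[of \<nu>] by (simp add: mult_le_0_iff antisym)
    moreover have "integrable \<nu> (\<lambda>x. infdist x S)"
      by (intro invariant_integrable[OF comp \<nu>] continuous_intros)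
    ultimately have "AE x in \<nu>. infdist x S = 0"
      by (subst (asm) integral_nonneg_eq_0_iff_AE) (auto simp: infdist_nonneg)
    then have AE: "AE x in \<nu>. x \<in> S"
      using in_closed_iff_infdist_zero[OF finite_imp_closed[OF finS(1)] finS(2)] by simp
    interpret prob_space \<nu> using \<nu> by (simp add: invariant_measures_def)
    have "S \<in> sets \<nu>"
      using \<nu> finite_imp_closed[OF finS(1)] by (simp add: invariant_measures_def borel_closed)
    then have "measure \<nu> S = 1" using AE by (simp add: prob_eq_1)
    then show ?thesis
      using invariant_measure_of_orbit_unique[OF T p(2) \<nu> _ \<mu>] \<mu>S unfolding S_def by blast
  qed
  moreover have "maximizing_measure T F \<mu>"
    using \<mu> sup attained by (simp add: maximizing_measure_def \<mu>_def)
  ultimately show ?thesis unfolding \<mu>_def by blast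
qed

text \<open>For invariant \<open>\<nu>\<close> the Birkhoff sum of length \<open>n\<close> integrates to \<open>n\<close> times the integral of \<open>G\<close>,
  so a bound independent of \<open>n\<close> leaves no room for a positive integral.\<close>
lemma invariant_integral_nonpos:
  fixes T :: "'a::metric_space \<Rightarrow> 'a"
  assumes comp: "compact (UNIV :: 'a set)" and T: "continuous_on UNIV T"
    and \<nu>: "\<nu> \<in> invariant_measures T" and G: "continuous_on UNIV G"
    and le: "\<And>n x. birkhoff_sum T G n x \<le> A"
  shows "integral\<^sup>L \<nu> G \<le> 0"
proof -
  interpret prob_space \<nu> using \<nu> by (simp add: invariant_measures_def)
  have iter: "continuous_on UNIV (\<lambda>x. (T ^^ k) x)" for k
  proof (induction k)
    case (Suc k)
    then show ?case using continuous_on_compose2[OF T Suc] by simp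
  qed simp
  have GT: "continuous_on UNIV (\<lambda>x. G ((T ^^ k) x))" for k
    using continuous_on_compose2[OF G iter] by simp
  have eq: "integral\<^sup>L \<nu> (\<lambda>x. G ((T ^^ k) x)) = integral\<^sup>L \<nu> G" for k
  proof (induction k)
    case (Suc k)
    have "integral\<^sup>L \<nu> (\<lambda>x. G ((T ^^ k) (T x))) = integral\<^sup>L \<nu> (\<lambda>x. G ((T ^^ k) x))"
      by (intro invariant_integral_comp[OF \<nu>, of "\<lambda>x. G ((T ^^ k) x)"] borel_measurable_continuous_onI T GT)
    then show ?case using Suc by (simp add: funpow_swap1)
  qed simp
  have n: "real n * integral\<^sup>L \<nu> G \<le> A" for n
  proof -
    have "real n * integral\<^sup>L \<nu> G = (\<Sum>k<n. integral\<^sup>L \<nu> (\<lambda>x. G ((T ^^ k) x)))"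
      by (simp add: eq)
    also have "\<dots> = integral\<^sup>L \<nu> (\<lambda>x. birkhoff_sum T G n x)"
      unfolding birkhoff_sum_def
      by (intro Bochner_Integration.integral_sum[symmetric] invariant_integrable[OF comp \<nu>] GT)
    also have "\<dots> \<le> integral\<^sup>L \<nu> (\<lambda>x. A)"
    proof (rule integral_mono)
      show "integrable \<nu> (\<lambda>x. birkhoff_sum T G n x)"
        unfolding birkhoff_sum_def
        by (intro Bochner_Integration.integrable_sum invariant_integrable[OF comp \<nu>] GT)
    qed (use le in auto)
    finally show ?thesis by (simp add: prob_space)
  qed
  show ?thesis
  proof (rule ccontr)
    assume "\<not> ?thesis"
    then obtain n where "A < real n * integral\<^sup>L \<nu> G" using ex_less_of_nat_mult[of "integral\<^sup>L \<nu> G" A] by auto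
    then show False using n[of n] by linarith
  qed
qed

section \<open>Density of the locked functions\<close>

lemma lip_norm_ge_lipschitz:
  fixes f :: "'a::metric_space \<Rightarrow> real"
  assumes "compact (UNIV :: 'a set)" "f \<in> lip_functions"
  shows "\<bar>f x - f y\<bar> \<le> lip_norm f * dist x y"
proof -
  have "\<bar>f x\<bar> \<le> (SUP x. \<bar>f x\<bar>)"
    by (rule cSUP_upper[OF UNIV_I lip_bdd_above_abs[OF assms]])
  moreover have "\<bar>f x - f y\<bar> / dist x y \<le> (SUP (x, y). \<bar>f x - f y\<bar> / dist x y)"
    using cSUP_upper[OF UNIV_I lip_bdd_above_quot[OF assms(2)], of "(x, y)"] by simp
  ultimately have "\<bar>f x - f y\<bar> / dist x y \<le> lip_norm f"
    unfolding lip_norm_def by linarith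
  then show ?thesis by (cases "x = y") (auto simp: divide_le_eq)
qed

lemma lip_norm_le:
  fixes f :: "'a::metric_space \<Rightarrow> real"
  assumes "\<And>x. \<bar>f x\<bar> \<le> a" "\<And>x y. \<bar>f x - f y\<bar> \<le> b * dist x y" "0 \<le> b"
  shows "lip_norm f \<le> a + b"
  unfolding lip_norm_def
proof (rule add_mono)
  show "(SUP x. \<bar>f x\<bar>) \<le> a" using assms(1) by (intro cSUP_least) auto
  show "(SUP (x, y). \<bar>f x - f y\<bar> / dist x y) \<le> b"
  proof (rule cSUP_least, simp, clarify)
    fix x y
    show "\<bar>f x - f y\<bar> / dist x y \<le> b"
      using assms(2)[of x y] assms(3) by (cases "x = y") (auto simp: divide_le_eq)
  qed
qed

context uniformly_expanding
begin

text \<open>Only half of the penalty \<open>2 * \<epsilon> * infdist x S\<close> is spent on the locking estimate; the other half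
  gives uniqueness. The perturbation \<open>u\<close> costs at most \<open>2 * a\<close> at each time. The number \<open>\<theta>\<close> is
  chosen so that \<open>\<theta> * \<gamma> = \<epsilon> * r'\<close> for the radii \<open>r'\<close> and \<open>r\<close> used in the locking estimate; the conditions
  on \<open>\<tau>\<close> and \<open>a\<close> bound the two contributions to the error \<open>p * b\<close> by a quarter of this each.\<close>
lemma unique_maximizing_near_normal_form:
  fixes f g h u :: "'a \<Rightarrow> real" and y :: 'a and p :: nat and M \<epsilon> \<tau> a \<gamma> \<theta> :: real
  assumes g: "M-lipschitz_on UNIV g" "\<And>x. g x \<le> 0" "\<And>z. z \<in> Z \<Longrightarrow> g z = 0" "Z \<noteq> {}" and M: "M > 0"
    and h: "continuous_on UNIV h"
    and p: "1 \<le> p" "(T ^^ p) y = y"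
    and gap: "0 < \<gamma>" "\<gamma> \<le> rho" "\<And>i j. i < j \<Longrightarrow> j < p \<Longrightarrow> \<gamma> \<le> dist ((T ^^ i) y) ((T ^^ j) y)"
    and close: "(\<Sum>k<p. infdist ((T ^^ k) y) Z) \<le> \<tau> * \<gamma>"
    and \<epsilon>: "0 < \<epsilon>" "\<epsilon> \<le> 1"
    and \<theta>: "\<theta> = \<epsilon>^2 * (1 - lam) / (2 * (M + 1) * (1 + L))" "4 * M * \<tau> \<le> \<theta>"
    and u: "1-lipschitz_on UNIV u" "\<And>x. \<bar>u x\<bar> \<le> a" "8 * real p * a \<le> \<theta> * \<gamma>"
  defines "S \<equiv> (\<lambda>k. (T ^^ k) y) ` {..<p}"
  assumes F: "\<And>x. F x = g x + u x - 2 * \<epsilon> * infdist x S + \<beta> - h x + h (T x)"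
  shows "{\<nu>. maximizing_measure T F \<nu>} = {orbit_measure T p y}"
proof -
  define v where "v x = g x + u x" for x
  define vbar where "vbar = birkhoff_sum T v p y / p"
  define b where "b = M * \<tau> * \<gamma> / p + 2 * a"
  define r where "r = \<gamma> / (1 + L)"
  define r' where "r' = r * (\<epsilon> * (1 - lam) / (2 * (M + 1)))"
  have contT: "continuous_on UNIV T" using continuous_on_iterate[of UNIV 1] by simp
  have v: "(M + 1)-lipschitz_on UNIV v"
    using lipschitz_on_add[OF g(1) u(1)] by (simp add: v_def[abs_def])
  have contv: "continuous_on UNIV v" by (rule lipschitz_on_continuous_on[OF v])
  have contd: "continuous_on UNIV (\<lambda>x. infdist x S)" by (intro continuous_intros)
  have p0: "real p > 0" using p by simp
  have \<tau>: "0 \<le> \<tau>"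
  proof -
    have "0 \<le> \<tau> * \<gamma>" using close sum_nonneg[of "{..<p}" "\<lambda>k. infdist ((T ^^ k) y) Z"] infdist_nonneg
      by (meson order_trans)
    then show ?thesis using gap(1) by (simp add: zero_le_mult_iff)
  qed
  have a: "0 \<le> a" using u(2)[of undefined] by linarith
  have g_ge: "- (M * infdist x Z) \<le> g x" for x
  proof -
    have "- g x / M \<le> dist x z" if "z \<in> Z" for z
      using lipschitz_onD[OF g(1), of x z] g(3)[OF that] M by (simp add: dist_real_def field_simps)
    then have "- g x / M \<le> infdist x Z"
      using g(4) by (simp add: infdist_def cINF_greatest)
    then show ?thesis using M by (simp add: field_simps)
  qed
  have vbar: "- (M * \<tau> * \<gamma> / p) - a \<le> vbar"
  proof -
    have "- (M * (\<tau> * \<gamma>)) \<le> - (M * (\<Sum>k<p. infdist ((T ^^ k) y) Z))"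
      using mult_left_mono[OF close, of M] M by simp
    also have "\<dots> = (\<Sum>k<p. - (M * infdist ((T ^^ k) y) Z))"
      by (simp add: sum_distrib_left sum_negf)
    also have "\<dots> \<le> (\<Sum>k<p. v ((T ^^ k) y) + a)"
    proof (rule sum_mono)
      fix k
      show "- (M * infdist ((T ^^ k) y) Z) \<le> v ((T ^^ k) y) + a"
        using g_ge[of "(T ^^ k) y"] u(2)[of "(T ^^ k) y"] by (simp add: v_def)
    qed
    also have "\<dots> = p * vbar + p * a" using p0 by (simp add: vbar_def birkhoff_sum_def sum.distrib)
    finally show ?thesis using p0 by (simp add: field_simps)
  qed
  have top: "v x \<le> vbar + b" for x
    using g(2)[of x] u(2)[of x] vbar by (simp add: v_def b_def)
  have b: "0 \<le> b" using M \<tau> gap(1) a by (simp add: b_def)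
  have \<theta>r: "\<theta> * \<gamma> = \<epsilon> * r'" by (simp add: \<theta>(1) r'_def r_def power2_eq_square mult_ac)
  have "4 * M * \<tau> * \<gamma> \<le> \<theta> * \<gamma>" using \<theta>(2) gap(1) by (intro mult_right_mono) auto
  moreover have "p * b = M * \<tau> * \<gamma> + 2 * (p * a)" using p0 by (simp add: b_def field_simps)
  ultimately have pb: "2 * (p * b) \<le> \<epsilon> * r'" using u(3) \<theta>r by simp
  have "1 * b \<le> p * b" using p b by (intro mult_right_mono) auto
  then have b1: "b \<le> \<epsilon> * r'" "(p + 1) * b \<le> \<epsilon> * r'" using pb b by (simp_all add: distrib_right)
  have r: "0 < r" "(1 + L) * r = \<gamma>" using gap(1) L by (auto simp: r_def)
  have "r \<le> \<gamma>" using L gap(1) by (simp add: r_def field_simps)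
  have k: "0 < \<epsilon> * (1 - lam) / (2 * (M + 1))" "\<epsilon> * (1 - lam) / (2 * (M + 1)) \<le> 1 / 2"
  proof -
    show "0 < \<epsilon> * (1 - lam) / (2 * (M + 1))" using \<epsilon> lam M by simp
    have "\<epsilon> * (1 - lam) \<le> 1 * 1" using \<epsilon> lam by (intro mult_mono) auto
    then show "\<epsilon> * (1 - lam) / (2 * (M + 1)) \<le> 1 / 2" using M by (simp add: field_simps)
  qed
  have r': "0 < r'" "r' \<le> r * (1 / 2)"
    unfolding r'_def using mult_pos_pos[OF r(1) k(1)] mult_left_mono[OF k(2), of r] r(1) by linarith+
  have "\<epsilon> * r' \<le> \<epsilon> * (r * (1 / 2))" using r' \<epsilon> by (intro mult_left_mono) auto
  moreover have "(M + 1) * r' / (1 - lam) = \<epsilon> * r / 2"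
  proof -
    have "q * (r * (\<epsilon> * w / (2 * q))) / w = \<epsilon> * r / 2" if "q \<noteq> 0" "w \<noteq> 0" for q w
      using that by simp
    from this[of "M + 1" "1 - lam"] show ?thesis unfolding r'_def using M lam by simp
  qed
  ultimately have pay: "(p + 1) * b + (M + 1) * r' / (1 - lam) \<le> \<epsilon> * r"
    using b1(2) by simp
  have locked: "integral\<^sup>L \<nu> (\<lambda>x. v x - vbar - \<epsilon> * infdist x S) \<le> 0"
    if "\<nu> \<in> invariant_measures T" for \<nu>
  proof (rule invariant_integral_nonpos[OF compact_space contT that])
    show "continuous_on UNIV (\<lambda>x. v x - vbar - \<epsilon> * infdist x S)"
      by (intro continuous_intros contv contd)
    show "birkhoff_sum T (\<lambda>x. v x - vbar - \<epsilon> * infdist x S) n x \<le> p * b + (M + 1) * r' / (1 - lam)" for n x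
      unfolding S_def
    proof (rule birkhoff_sum_locked[OF p gap(3) v top b _ r'(1)])
      show "birkhoff_sum T v p y = p * vbar" using p0 by (simp add: vbar_def)
      show "r' \<le> r" "r \<le> rho" "(1 + L) * r \<le> \<gamma>" using r' r \<open>r \<le> \<gamma>\<close> gap by auto
      show "b \<le> \<epsilon> * r'" "0 \<le> \<epsilon>" using b1 \<epsilon> by auto
      show "real (p + 1) * b + (M + 1) * r' / (1 - lam) \<le> \<epsilon> * r" using pay by simp
    qed
  qed
  have contF: "continuous_on UNIV F"
    unfolding F[abs_def]
    by (intro continuous_intros h contd lipschitz_on_continuous_on[OF g(1)]
        lipschitz_on_continuous_on[OF u(1)] continuous_on_compose2[OF h contT]) auto
  have Tm: "T \<in> borel_measurable borel" by (rule borel_measurable_continuous_onI[OF contT])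
  have intF: "integral\<^sup>L \<nu> F = \<beta> + integral\<^sup>L \<nu> v - 2 * \<epsilon> * integral\<^sup>L \<nu> (\<lambda>x. infdist x S)"
    if \<nu>: "\<nu> \<in> invariant_measures T" for \<nu>
  proof -
    interpret prob_space \<nu> using \<nu> by (simp add: invariant_measures_def)
    note [simp] = invariant_integrable[OF compact_space \<nu> contv]
      invariant_integrable[OF compact_space \<nu> contd] invariant_integrable[OF compact_space \<nu> h]
    have hT: "integrable \<nu> (\<lambda>x. h (T x))"
      by (intro invariant_integrable[OF compact_space \<nu>] continuous_on_compose2[OF h contT]) auto
    have "F = (\<lambda>x. v x - 2 * \<epsilon> * infdist x S + \<beta> - h x + h (T x))"
      by (rule ext) (simp add: F v_def)
    then have "integral\<^sup>L \<nu> F = integral\<^sup>L \<nu> v - 2 * \<epsilon> * integral\<^sup>L \<nu> (\<lambda>x. infdist x S) + \<beta>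
        - integral\<^sup>L \<nu> h + integral\<^sup>L \<nu> (\<lambda>x. h (T x))"
      using hT by (simp add: prob_space)
    moreover have "integral\<^sup>L \<nu> (\<lambda>x. h (T x)) = integral\<^sup>L \<nu> h"
      by (intro invariant_integral_comp[OF \<nu> Tm] borel_measurable_continuous_onI h)
    ultimately show ?thesis by simp
  qed
  show ?thesis
  proof (rule unique_maximizing_measure[OF compact_space Tm p \<epsilon>(1), folded S_def])
    fix \<nu> assume \<nu>: "\<nu> \<in> invariant_measures T"
    interpret prob_space \<nu> using \<nu> by (simp add: invariant_measures_def)
    note [simp] = invariant_integrable[OF compact_space \<nu> contv]
      invariant_integrable[OF compact_space \<nu> contd]
    have "integral\<^sup>L \<nu> v - vbar - \<epsilon> * integral\<^sup>L \<nu> (\<lambda>x. infdist x S) \<le> 0"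
      using locked[OF \<nu>] by (simp add: prob_space)
    then show "integral\<^sup>L \<nu> F \<le> (\<beta> + vbar) - \<epsilon> * integral\<^sup>L \<nu> (\<lambda>x. infdist x S)"
      using intF[OF \<nu>] by simp
  next
    have \<mu>: "orbit_measure T p y \<in> invariant_measures T" by (rule orbit_measure_invariant[OF p Tm])
    have "integral\<^sup>L (orbit_measure T p y) v = vbar"
      using integral_orbit_measure[OF p(1) borel_measurable_continuous_onI[OF contv]]
      by (simp add: vbar_def)
    moreover have "integral\<^sup>L (orbit_measure T p y) (\<lambda>x. infdist x S) = 0"
      using integral_orbit_measure[OF p(1) borel_measurable_continuous_onI[OF contd], of T y]
      by (simp add: birkhoff_sum_def S_def)
    ultimately show "integral\<^sup>L (orbit_measure T p y) F = \<beta> + vbar"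
      using intF[OF \<mu>] by simp
  qed
qed

text \<open>The constants are chosen in the order \<open>\<epsilon>\<close>, \<open>\<theta>\<close>, \<open>\<tau>\<close>, then the periodic orbit together with \<open>\<gamma>\<close>,
  and last the radius \<open>a\<close>: the penalty must be small before the orbit is known, and only the size of
  the further perturbation may depend on the orbit.\<close>
lemma locking_perturbation:
  assumes f: "f \<in> lip_functions" and \<epsilon>0: "\<epsilon>0 > 0"
  shows "\<exists>f1\<in>lip_functions. lip_dist f f1 < \<epsilon>0 \<and> (\<exists>a>0. \<forall>F\<in>lip_functions. lip_dist f1 F < a \<longrightarrow>
    (\<exists>p y. 1 \<le> p \<and> (T ^^ p) y = y \<and> {\<nu>. maximizing_measure T F \<nu>} = {orbit_measure T p y}))"
proof -
  obtain C where C: "C-lipschitz_on UNIV f" using f by (auto simp: lip_functions_def)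
  obtain \<beta> h K Z where h: "K-lipschitz_on UNIV h" and Z: "Z \<noteq> {}" "T ` Z \<subseteq> Z"
    and le: "\<And>x. f x - \<beta> + h x - h (T x) \<le> 0"
    and zero: "\<And>z. z \<in> Z \<Longrightarrow> f z - \<beta> + h z - h (T z) = 0"
    using normal_form[OF C] by blast
  define g where "g x = f x - \<beta> + h x - h (T x)" for x
  define M where "M = C + K + K * L + 1"
  have C0: "C \<ge> 0" "K \<ge> 0" using lipschitz_on_nonneg[OF C] lipschitz_on_nonneg[OF h] by auto
  have M: "M > 0" using C0 L by (simp add: M_def add_nonneg_pos)
  have g: "M-lipschitz_on UNIV g"
  proof (rule lipschitz_onI)
    fix x y
    have "dist (g x) (g y) \<le> dist (f x) (f y) + dist (h x) (h y) + dist (h (T x)) (h (T y))"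
      by (simp add: g_def dist_real_def)
    also have "\<dots> \<le> C * dist x y + K * dist x y + K * (L * dist x y)"
      using lipschitz_onD[OF C, of x y] lipschitz_onD[OF h, of x y] lipschitz_onD[OF h, of "T x" "T y"]
        mult_left_mono[OF lipschitz[of x y] C0(2)] by simp
    also have "\<dots> \<le> M * dist x y" by (simp add: M_def algebra_simps)
    finally show "dist (g x) (g y) \<le> M * dist x y" .
  qed (use M in simp)
  have "bounded (UNIV :: 'a set)" using compact_space by (rule compact_imp_bounded)
  then obtain B where B: "\<And>x y :: 'a. dist x y \<le> B"
    unfolding bounded_two_points by auto
  have B0: "B \<ge> 0" using B[of undefined undefined] by simp
  define \<epsilon> where "\<epsilon> = min 1 (\<epsilon>0 / (4 * (B + 1)))"
  have \<epsilon>: "0 < \<epsilon>" "\<epsilon> \<le> 1" "2 * \<epsilon> * (B + 1) < \<epsilon>0"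
  proof -
    show "0 < \<epsilon>" "\<epsilon> \<le> 1" using \<epsilon>0 B0 by (auto simp: \<epsilon>_def)
    have "\<epsilon> * (B + 1) \<le> \<epsilon>0 / (4 * (B + 1)) * (B + 1)"
      using B0 by (intro mult_right_mono) (auto simp: \<epsilon>_def)
    also have "\<dots> = \<epsilon>0 / 4" using B0 by (simp add: divide_simps)
    finally show "2 * \<epsilon> * (B + 1) < \<epsilon>0" using \<epsilon>0 by simp
  qed
  define \<theta> where "\<theta> = \<epsilon>^2 * (1 - lam) / (2 * (M + 1) * (1 + L))"
  have \<theta>: "\<theta> > 0" using \<epsilon> lam M L by (simp add: \<theta>_def)
  define \<tau> where "\<tau> = \<theta> / (4 * M)"
  have \<tau>: "\<tau> > 0" "4 * M * \<tau> \<le> \<theta>" using \<theta> M by (auto simp: \<tau>_def)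
  obtain p y \<gamma> where p: "1 \<le> p" "(T ^^ p) y = y" and \<gamma>: "0 < \<gamma>" "\<gamma> \<le> rho"
    "\<And>i j. i < j \<Longrightarrow> j < p \<Longrightarrow> \<gamma> \<le> dist ((T ^^ i) y) ((T ^^ j) y)"
    and close: "(\<Sum>k<p. infdist ((T ^^ k) y) Z) \<le> \<tau> * \<gamma>"
    using separated_periodic_orbit[OF Z(2,1) \<tau>(1)] by blast
  define S where "S = (\<lambda>k. (T ^^ k) y) ` {..<p}"
  define f1 where "f1 x = f x - 2 * \<epsilon> * infdist x S" for x
  have yS: "y \<in> S" using p unfolding S_def by (intro image_eqI[of _ _ 0]) auto
  have d: "\<bar>2 * \<epsilon> * infdist x S - 2 * \<epsilon> * infdist z S\<bar> \<le> 2 * \<epsilon> * dist x z" for x z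
  proof -
    have "\<bar>infdist x S - infdist z S\<bar> \<le> dist x z"
      using infdist_triangle[of x S z] infdist_triangle[of z S x] by (auto simp: dist_commute abs_le_iff)
    then have "2 * \<epsilon> * \<bar>infdist x S - infdist z S\<bar> \<le> 2 * \<epsilon> * dist x z"
      using \<epsilon> by (intro mult_left_mono) auto
    then show ?thesis using \<epsilon> by (simp add: abs_mult flip: right_diff_distrib)
  qed
  have d_lip: "(\<lambda>x. 2 * \<epsilon> * infdist x S) \<in> lip_functions"
    unfolding lip_functions_def using d \<epsilon>
    by (intro CollectI exI[of _ "2 * \<epsilon>"] lipschitz_onI) (auto simp: dist_real_def)
  have f1: "f1 \<in> lip_functions"
    using lip_functions_diff[OF f d_lip] by (simp add: f1_def[abs_def])
  have "lip_norm (\<lambda>x. 2 * \<epsilon> * infdist x S) \<le> 2 * \<epsilon> * B + 2 * \<epsilon>"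
  proof (rule lip_norm_le[OF _ d])
    fix x
    have "infdist x S \<le> B" using infdist_le[OF yS, of x] B[of x y] by linarith
    then have "2 * \<epsilon> * infdist x S \<le> 2 * \<epsilon> * B" using \<epsilon> by (intro mult_left_mono) auto
    then show "\<bar>2 * \<epsilon> * infdist x S\<bar> \<le> 2 * \<epsilon> * B" using \<epsilon> by (simp add: abs_mult infdist_nonneg)
  qed (use \<epsilon> in simp)
  then have "lip_dist f f1 < \<epsilon>0"
    using f f1 \<epsilon>(3) by (simp add: lip_dist_def f1_def algebra_simps)
  moreover define a where "a = min 1 (\<theta> * \<gamma> / (8 * real p))"
  have a: "0 < a" "a \<le> 1" "8 * real p * a \<le> \<theta> * \<gamma>"
  proof -
    show "0 < a" "a \<le> 1" using \<theta> \<gamma> p by (auto simp: a_def)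
    have "8 * real p * a \<le> 8 * real p * (\<theta> * \<gamma> / (8 * real p))"
      by (intro mult_left_mono) (auto simp: a_def)
    then show "8 * real p * a \<le> \<theta> * \<gamma>" using p by simp
  qed
  moreover have "{\<nu>. maximizing_measure T F \<nu>} = {orbit_measure T p y}"
    if F: "F \<in> lip_functions" "lip_dist f1 F < a" for F
  proof -
    define u where "u x = f1 x - F x" for x
    have u: "u \<in> lip_functions" "lip_norm u < a"
      using lip_functions_diff[OF f1 F(1)] F f1 by (auto simp: u_def[abs_def] lip_dist_def)
    have u_abs: "\<bar>- u x\<bar> \<le> a" for x using lip_norm_ge_abs[OF compact_space u(1), of x] u(2) by simp
    have u_lip: "1-lipschitz_on UNIV (\<lambda>x. - u x)"
    proof (rule lipschitz_onI)
      fix x z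
      have "\<bar>u x - u z\<bar> \<le> lip_norm u * dist x z" by (rule lip_norm_ge_lipschitz[OF compact_space u(1)])
      also have "\<dots> \<le> 1 * dist x z" using u(2) a(2) by (intro mult_right_mono) auto
      finally show "dist (- u x) (- u z) \<le> 1 * dist x z" by (simp add: dist_real_def)
    qed simp
    have "F x = g x + - u x - 2 * \<epsilon> * infdist x S + \<beta> - h x + h (T x)" for x
      by (simp add: g_def u_def f1_def)
    then show ?thesis
      using unique_maximizing_near_normal_form[OF g le[folded g_def] zero[folded g_def] Z(1) M
          lipschitz_on_continuous_on[OF h] p \<gamma> close \<epsilon>(1,2) \<theta>_def \<tau>(2) u_lip u_abs a(3)]
      unfolding S_def by blast
  qed
  ultimately show ?thesis using f1 p by blast
qed

end

theorem theorem1: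
  fixes T :: "'a::metric_space \<Rightarrow> 'a"
  assumes "compact (UNIV :: 'a set)"
    and "expanding T"
  shows "\<exists>\<O>. openin lip_topology \<O> \<and> lip_topology closure_of \<O> = lip_functions \<and>
    (\<forall>F\<in>\<O>. \<exists>\<mu>. {\<nu>. maximizing_measure T F \<nu>} = {\<mu>} \<and>
       (\<exists>A. periodic_orbit T A \<and> emeasure \<mu> A = 1))"
proof -
  obtain lam rho L where "uniformly_expanding T lam rho L"
    using expanding_imp_uniformly_expanding[OF assms] by blast
  then interpret uniformly_expanding T lam rho L .
  interpret Lip: Metric_space "lip_functions :: ('a \<Rightarrow> real) set" lip_dist
    by (rule Metric_space_lip[OF assms(1)])
  have top: "lip_topology = Lip.mtopology" by (rule lip_topology_def)
  define G where "G = {F \<in> lip_functions. \<exists>p y. 1 \<le> p \<and> (T ^^ p) y = y \<and>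
    {\<nu>. maximizing_measure T F \<nu>} = {orbit_measure T p y}}"
  define \<O> where "\<O> = Lip.mtopology interior_of G"
  have "openin lip_topology \<O>" by (simp add: \<O>_def top)
  moreover have "lip_topology closure_of \<O> = lip_functions"
  proof
    show "lip_topology closure_of \<O> \<subseteq> lip_functions"
      using closure_of_subset_topspace[of lip_topology \<O>] by (simp add: top)
    show "lip_functions \<subseteq> lip_topology closure_of \<O>"
    proof
      fix f :: "'a \<Rightarrow> real" assume f: "f \<in> lip_functions"
      have "\<exists>f1\<in>\<O>. f1 \<in> Lip.mball f \<epsilon>" if "\<epsilon> > 0" for \<epsilon>
      proof -
        obtain f1 a where f1: "f1 \<in> lip_functions" "lip_dist f f1 < \<epsilon>" "a > 0"
          "\<And>F. F \<in> lip_functions \<Longrightarrow> lip_dist f1 F < a \<Longrightarrow> \<exists>p y. 1 \<le> p \<and> (T ^^ p) y = y \<and>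
            {\<nu>. maximizing_measure T F \<nu>} = {orbit_measure T p y}"
          using locking_perturbation[OF f \<open>\<epsilon> > 0\<close>] by blast
        have "Lip.mball f1 a \<subseteq> G" using f1(4) by (auto simp: G_def Lip.in_mball)
        then have "Lip.mball f1 a \<subseteq> \<O>"
          unfolding \<O>_def by (rule interior_of_maximal[OF _ Lip.openin_mball])
        then show ?thesis using f f1 by (intro bexI[of _ f1]) auto
      qed
      then show "f \<in> lip_topology closure_of \<O>"
        using f unfolding top Lip.metric_closure_of by blast
    qed
  qed
  moreover have "\<exists>\<mu>. {\<nu>. maximizing_measure T F \<nu>} = {\<mu>} \<and>
      (\<exists>A. periodic_orbit T A \<and> emeasure \<mu> A = 1)" if "F \<in> \<O>" for F
  proof -
    have "F \<in> G" using that interior_of_subset[of Lip.mtopology G] unfolding \<O>_def by blast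
    then obtain p y where p: "1 \<le> p" "(T ^^ p) y = y"
      "{\<nu>. maximizing_measure T F \<nu>} = {orbit_measure T p y}" by (auto simp: G_def)
    define A where "A = (\<lambda>k. (T ^^ k) y) ` {..<p}"
    have "periodic_orbit T A" unfolding periodic_orbit_def A_def using p by blast
    moreover have "emeasure (orbit_measure T p y) A = 1"
    proof -
      have "continuous_on UNIV T" using continuous_on_iterate[of UNIV 1] by simp
      then interpret prob_space "orbit_measure T p y"
        using orbit_measure_invariant[OF p(1,2) borel_measurable_continuous_onI]
        by (simp add: invariant_measures_def)
      show ?thesis
        using measure_orbit_measure[OF p(1), of T y] by (simp add: A_def emeasure_eq_measure)
    qed
    ultimately show ?thesis using p(3) by blast
  qed
  ultimately show ?thesis by blast
qed

end
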